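(* Let $G<\operatorname{Aut}(T_d)$ be a contracting self-similar regular branch group acting on the $d$-ary rooted tree $T_d$, generated by a finite symmetric set $S$ that contains the nucleus of $G$. There is an algorithm that, given the nucleus portrait $\pi(g)$ of an element $g\in G$ that can be defined by an (unknown) word in $S$ of length up to $n$, constructs a word in $S$ of length polynomial in $n$ representing $g$. The complexity of this algorithm is polynomial in $n$.
   Context: Let $X$ be an alphabet with $d$ letters. $T_d$ is identified with the set $X^*$ of finite words over $X$ ($v$ is adjacent to $vx$; the root is the empty word; level $n$ is $X^n$), and $\operatorname{Aut}(T_d)$ is its group of rooted tree automorphisms. Actions are right actions: $gh(y)=h(g(y))$. For $g\in\operatorname{Aut}(T_d)$ and $v\in X^*$, the section $g|_v$ is the automorphism defined by $g(vw)=g(v)\,g|_v(w)$ for all $w\in X^*$. A group $G<\operatorname{Aut}(T_d)$ is self-similar if $g|_x\in G$ for all $g\in G$, $x\in X$. A self-similar group $G$ is contracting if there is a finite set $\mathcal N\subset G$ such that for each $g\in G$ there is $l\ge 0$ with $g|_v\in\mathcal N$ for all $v\in X^k$ and all $k\ge l$; the minimal such $\mathcal N$ is the nucleus of $G$. The nucleus portrait $\pi(g)$ is the finite labeled rooted tree defined recursively: if $g\in\mathcal N$, it is a single vertex labeled by $g$; otherwise it consists of a root labeled by the permutation of $X$ induced by $g$ on the first level, with $d$ children (indexed by $x\in X$) that are the roots of the nucleus portraits of $g|_x$, $x\in X$. Let $\operatorname{St}_G(1)$ be the stabilizer of the first level in $G$ (the elements fixing every vertex of level $1$), and let $\Psi:\operatorname{St}_G(1)\hookrightarrow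 G^d$ be the embedding sending $g$ to the tuple of its sections at the vertices of the first level. A self-similar group $G$ is a regular branch group over a nontrivial subgroup $K\le G$ if $G$ acts transitively on each level of $X^*$, $K^d\le\Psi(\operatorname{St}_G(1)\cap K)$, $[G:K]<\infty$, and $[\Psi(\operatorname{St}_G(1)\cap K):K^d]<\infty$. $G$ is a regular branch group if it is so over some such $K$. The group $G$ and the set $S$ are fixed; only the nucleus portrait is the input of the algorithm, and "polynomial in $n$" means bounded above by a polynomial in $n$ that depends only on $G$ and $S$. *)

theory Defs
  imports
    "HOL-Algebra.Product_Groups"
    "HOL-Computational_Algebra.Polynomial"
begin

section \<open>Rooted tree automorphisms and self-similar groups\<close>

text \<open>
  The alphabet \<open>X\<close> is a finite type \<open>'x\<close> (so \<open>d = CARD('x)\<close>), and the vertices of the tree are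
  the words of type \<open>'x list\<close>.
\<close>

definition tree_adj :: "'x list \<Rightarrow> 'x list \<Rightarrow> bool" where
  "tree_adj u v \<longleftrightarrow> (\<exists>x. v = u @ [x]) \<or> (\<exists>x. u = v @ [x])"

definition tree_auts :: "('x list \<Rightarrow> 'x list) set" where
  "tree_auts = {g. bij g \<and> g [] = [] \<and> (\<forall>u v. tree_adj (g u) (g v) \<longleftrightarrow> tree_adj u v)}"

text \<open>Actions are right actions: the product \<open>g h\<close> applies \<open>g\<close> first.\<close>

definition AutT :: "('x list \<Rightarrow> 'x list) monoid" where
  "AutT = \<lparr>carrier = tree_auts, monoid.mult = (\<lambda>g h. h \<circ> g), one = id\<rparr>"

text \<open>
  An automorphism preserves levels and prefixes, so cutting \<open>g v\<close> off \<open>g (v @ w)\<close> amounts to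
  dropping \<open>length v\<close> letters; see \<open>section_at_append\<close> and \<open>section_at_unique\<close>.
\<close>

definition section_at :: "('x list \<Rightarrow> 'x list) \<Rightarrow> 'x list \<Rightarrow> 'x list \<Rightarrow> 'x list" where
  "section_at g v = (\<lambda>w. drop (length v) (g (v @ w)))"

definition perm_at_root :: "('x list \<Rightarrow> 'x list) \<Rightarrow> 'x \<Rightarrow> 'x" where
  "perm_at_root g = (\<lambda>x. hd (g [x]))"

definition self_similar :: "('x list \<Rightarrow> 'x list) set \<Rightarrow> bool" where
  "self_similar G \<longleftrightarrow> subgroup G AutT \<and> (\<forall>g\<in>G. \<forall>x. section_at g [x] \<in> G)"

definition absorbs_sections :: "('x list \<Rightarrow> 'x list) set \<Rightarrow> ('x list \<Rightarrow> 'x list) set \<Rightarrow> bool" where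
  "absorbs_sections G N \<longleftrightarrow>
     finite N \<and> N \<subseteq> G \<and>
     (\<forall>g\<in>G. \<exists>l. \<forall>k\<ge>l. \<forall>v. length v = k \<longrightarrow> section_at g v \<in> N)"

definition contracting :: "('x list \<Rightarrow> 'x list) set \<Rightarrow> bool" where
  "contracting G \<longleftrightarrow> self_similar G \<and> (\<exists>N. absorbs_sections G N)"

text \<open>Least with respect to inclusion; for contracting \<open>G\<close> it exists, see \<open>absorbs_nucleus\<close>.\<close>

definition nucleus :: "('x list \<Rightarrow> 'x list) set \<Rightarrow> ('x list \<Rightarrow> 'x list) set" where
  "nucleus G = (LEAST N. absorbs_sections G N)"


section \<open>Nucleus portraits\<close>

datatype ('x, 'g) portrait = Leaf 'g | Node "'x \<Rightarrow> 'x" "'x \<Rightarrow> ('x, 'g) portrait"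

inductive is_portrait ::
  "('x list \<Rightarrow> 'x list) set \<Rightarrow> ('x list \<Rightarrow> 'x list) \<Rightarrow> ('x, 'x list \<Rightarrow> 'x list) portrait \<Rightarrow> bool"
  for N where
  leaf: "g \<in> N \<Longrightarrow> is_portrait N g (Leaf g)"
| node: "g \<notin> N \<Longrightarrow> (\<And>x. is_portrait N (section_at g [x]) (c x)) \<Longrightarrow>
           is_portrait N g (Node (perm_at_root g) c)"

text \<open>
  For \<open>g\<close> in a contracting group the portrait exists and is unique, see \<open>is_portrait_nucleus\<close>.
\<close>

definition nucleus_portrait ::
  "('x list \<Rightarrow> 'x list) set \<Rightarrow> ('x list \<Rightarrow> 'x list) \<Rightarrow> ('x, 'x list \<Rightarrow> 'x list) portrait" where
  "nucleus_portrait G g = (THE t. is_portrait (nucleus G) g t)"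


section \<open>Regular branch groups\<close>

definition level1_stabilizer :: "('x list \<Rightarrow> 'x list) set \<Rightarrow> ('x list \<Rightarrow> 'x list) set" where
  "level1_stabilizer G = {g \<in> G. \<forall>x. g [x] = [x]}"

definition level1_sections :: "('x list \<Rightarrow> 'x list) \<Rightarrow> 'x \<Rightarrow> 'x list \<Rightarrow> 'x list" where
  "level1_sections g = (\<lambda>x. section_at g [x])"

definition power_group :: "('x \<Rightarrow> 'x list \<Rightarrow> 'x list) monoid" where
  "power_group = product_group UNIV (\<lambda>_. AutT)"

definition finite_index :: "('a, 'b) monoid_scheme \<Rightarrow> 'a set \<Rightarrow> 'a set \<Rightarrow> bool" where
  "finite_index A H L \<longleftrightarrow> finite (rcosets\<^bsub>A\<lparr>carrier := H\<rparr>\<^esub> L)"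

definition regular_branch_over ::
  "('x list \<Rightarrow> 'x list) set \<Rightarrow> ('x list \<Rightarrow> 'x list) set \<Rightarrow> bool" where
  "regular_branch_over G K \<longleftrightarrow>
     self_similar G \<and>
     subgroup K AutT \<and> K \<subseteq> G \<and> K \<noteq> {\<one>\<^bsub>AutT\<^esub>} \<and>
     (\<forall>u v. length u = length v \<longrightarrow> (\<exists>g\<in>G. g u = v)) \<and>
     (\<Pi>\<^sub>E x\<in>UNIV. K) \<subseteq> level1_sections ` (level1_stabilizer G \<inter> K) \<and>
     finite_index AutT G K \<and>
     finite_index power_group (level1_sections ` (level1_stabilizer G \<inter> K)) (\<Pi>\<^sub>E x\<in>UNIV. K)"

definition regular_branch :: "('x list \<Rightarrow> 'x list) set \<Rightarrow> bool" where
  "regular_branch G \<longleftrightarrow> (\<exists>K. regular_branch_over G K)"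


section \<open>Words in a generating set\<close>

definition word_value :: "('x list \<Rightarrow> 'x list) list \<Rightarrow> 'x list \<Rightarrow> 'x list" where
  "word_value w = foldr (\<lambda>s g. s \<otimes>\<^bsub>AutT\<^esub> g) w \<one>\<^bsub>AutT\<^esub>"


section \<open>Deterministic multi-tape Turing machines\<close>

text \<open>
  A machine has finitely many one-sided infinite tapes over a finite set of symbols. The
  symbols are the blank, input symbols, output symbols, and auxiliary symbols numbered by naturals;
  only finitely many of them belong to any one machine. States are the numbers below \<open>nstates\<close>, the
  initial state is \<open>0\<close>, and \<open>delta\<close> gives the new state together with the symbol to write and the
  head movement for every tape, or \<open>None\<close> if the machine halts.
\<close>

datatype ('i, 'o) symbol = Blank | In 'i | Out 'o | Aux nat

datatype move = MLeft | MStay | MRight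

record ('i, 'o) tm =
  ntapes :: nat
  nstates :: nat
  symbols :: "('i, 'o) symbol set"
  delta :: "nat \<Rightarrow> ('i, 'o) symbol list \<Rightarrow> (nat \<times> (('i, 'o) symbol \<times> move) list) option"

definition turing_machine :: "'i set \<Rightarrow> ('i, 'o) tm \<Rightarrow> bool" where
  "turing_machine A M \<longleftrightarrow>
     2 \<le> ntapes M \<and> 0 < nstates M \<and>
     finite (symbols M) \<and> Blank \<in> symbols M \<and> In ` A \<subseteq> symbols M \<and>
     (\<forall>q as q' acts.
        q < nstates M \<and> as \<in> lists (symbols M) \<and> length as = ntapes M \<and>
        delta M q as = Some (q', acts) \<longrightarrow>
        q' < nstates M \<and> length acts = ntapes M \<and> fst ` set acts \<subseteq> symbols M)"

type_synonym ('i, 'o) tape = "(nat \<Rightarrow> ('i, 'o) symbol) \<times> nat"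
type_synonym ('i, 'o) config = "nat \<times> ('i, 'o) tape list"

fun read_tape :: "('i, 'o) tape \<Rightarrow> ('i, 'o) symbol" where
  "read_tape (cells, h) = cells h"

text \<open>Moving left in the leftmost cell leaves the head in place.\<close>

fun move_head :: "move \<Rightarrow> nat \<Rightarrow> nat" where
  "move_head MLeft h = h - 1"
| "move_head MStay h = h"
| "move_head MRight h = h + 1"

fun act_on_tape :: "('i, 'o) symbol \<times> move \<Rightarrow> ('i, 'o) tape \<Rightarrow> ('i, 'o) tape" where
  "act_on_tape (s, m) (cells, h) = (cells(h := s), move_head m h)"

definition action :: "('i, 'o) tm \<Rightarrow> ('i, 'o) config \<Rightarrow> (nat \<times> (('i, 'o) symbol \<times> move) list) option" where
  "action M c = delta M (fst c) (map read_tape (snd c))"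

definition tm_step :: "('i, 'o) tm \<Rightarrow> ('i, 'o) config \<Rightarrow> ('i, 'o) config" where
  "tm_step M c =
     (case action M c of
        None \<Rightarrow> c
      | Some (q', acts) \<Rightarrow> (q', map2 act_on_tape acts (snd c)))"

definition word_on_tape :: "('i, 'o) symbol list \<Rightarrow> nat \<Rightarrow> ('i, 'o) symbol" where
  "word_on_tape ss i = (if i < length ss then ss ! i else Blank)"

text \<open>Tape \<open>0\<close> is the input tape and tape \<open>1\<close> is the output tape.\<close>

definition initial_config :: "('i, 'o) tm \<Rightarrow> 'i list \<Rightarrow> ('i, 'o) config" where
  "initial_config M u =
     (0, (word_on_tape (map In u), 0) # replicate (ntapes M - 1) (word_on_tape [], 0))"

text \<open>
  Halting configurations are fixed by \<open>tm_step\<close>, so the following says that \<open>M\<close> halts on input \<open>u\<close>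
  after at most \<open>t\<close> steps, leaving exactly \<open>w\<close> on the output tape.
\<close>

definition computes_within :: "('i, 'o) tm \<Rightarrow> 'i list \<Rightarrow> 'o list \<Rightarrow> nat \<Rightarrow> bool" where
  "computes_within M u w t \<longleftrightarrow>
     (let c = (tm_step M ^^ t) (initial_config M u)
      in action M c = None \<and> fst (snd c ! 1) = word_on_tape (map Out w))"


section \<open>Portraits as input words\<close>

text \<open>
  A portrait is written in preorder, the children of a vertex being listed in the order of a fixed
  enumeration \<open>xs\<close> of the alphabet. Since every inner vertex has the same number of children, this
  determines the portrait.
\<close>

type_synonym 'x label = "('x list \<Rightarrow> 'x list) + ('x \<Rightarrow> 'x)"

primrec encode_portrait :: "'x list \<Rightarrow> ('x, 'x list \<Rightarrow> 'x list) portrait \<Rightarrow> 'x label list" where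
  "encode_portrait xs (Leaf g) = [Inl g]"
| "encode_portrait xs (Node \<sigma> c) = Inr \<sigma> # concat (map (\<lambda>x. encode_portrait xs (c x)) xs)"

definition portrait_labels :: "('x list \<Rightarrow> 'x list) set \<Rightarrow> 'x label set" where
  "portrait_labels G = Inl ` nucleus G \<union> Inr ` {\<sigma>. bij \<sigma>}"


section \<open>Well-definedness of the notions above\<close>

lemma tree_aut_snoc:
  assumes g: "g \<in> tree_auts"
  shows "\<exists>y. g (v @ [x]) = g v @ [y]"
proof (induction v arbitrary: x rule: rev_induct)
  case Nil
  have "tree_adj [] [x]"
    by (simp add: tree_adj_def)
  then have "tree_adj (g []) (g [x])"
    using g unfolding tree_auts_def by blast
  then show ?case
    using g by (auto simp: tree_auts_def tree_adj_def)
next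
  case (snoc z u)
  obtain y where y: "g (u @ [z]) = g u @ [y]"
    using snoc by blast
  have inj: "inj g"
    using g by (auto simp: tree_auts_def bij_def)
  have "tree_adj (u @ [z]) ((u @ [z]) @ [x])"
    by (auto simp: tree_adj_def)
  then have "tree_adj (g (u @ [z])) (g ((u @ [z]) @ [x]))"
    using g unfolding tree_auts_def by blast
  moreover have "g ((u @ [z]) @ [x]) \<noteq> g u"
    using inj by (auto dest: injD)
  ultimately show ?case
    using y by (auto simp: tree_adj_def)
qed

lemma section_at_append:
  assumes g: "g \<in> tree_auts"
  shows "g (v @ w) = g v @ section_at g v w"
proof -
  have len: "length (g u) = length u" for u
  proof (induction u rule: rev_induct)
    case Nil
    then show ?case using g by (simp add: tree_auts_def)
  next
    case (snoc x u)
    then show ?case using tree_aut_snoc[OF g, of u x] by auto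
  qed
  have "\<exists>r. g (v @ w) = g v @ r"
  proof (induction w rule: rev_induct)
    case (snoc x w)
    then show ?case using tree_aut_snoc[OF g, of "v @ w" x] by auto
  qed simp
  then show ?thesis
    by (auto simp: section_at_def len)
qed

lemma section_at_unique:
  assumes "g \<in> tree_auts" and "\<And>w. g (v @ w) = g v @ h w"
  shows "section_at g v = h"
  using section_at_append[OF assms(1)] assms(2) by (metis ext same_append_eq)

lemma group_AutT: "group (AutT :: ('x list \<Rightarrow> 'x list) monoid)"
proof (rule groupI)
  fix g :: "'x list \<Rightarrow> 'x list"
  assume "g \<in> carrier AutT"
  then have g: "bij g" "g [] = []" "\<And>u v. tree_adj (g u) (g v) \<longleftrightarrow> tree_adj u v"
    by (auto simp: AutT_def tree_auts_def)
  let ?h = "inv_into UNIV g"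
  have "?h [] = []"
    using g by (metis bij_inv_eq_iff)
  moreover have "tree_adj (?h u) (?h v) \<longleftrightarrow> tree_adj u v" for u v
    using g by (metis bij_inv_eq_iff)
  ultimately have "?h \<in> carrier AutT"
    using g(1) by (auto simp: AutT_def tree_auts_def bij_imp_bij_inv)
  moreover have "?h \<otimes>\<^bsub>AutT\<^esub> g = \<one>\<^bsub>AutT\<^esub>"
    using g(1) by (auto simp: AutT_def bij_def surj_iff)
  ultimately show "\<exists>h\<in>carrier AutT. h \<otimes>\<^bsub>AutT\<^esub> g = \<one>\<^bsub>AutT\<^esub>"
    by blast
qed (auto simp: AutT_def tree_auts_def bij_comp)

lemma absorbs_nucleus:
  assumes "contracting G"
  shows "absorbs_sections G (nucleus G)"
    and "absorbs_sections G N \<Longrightarrow> nucleus G \<subseteq> N"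
proof -
  let ?P = "absorbs_sections G"
  have Int: "?P (A \<inter> B)" if A: "?P A" and B: "?P B" for A B
    unfolding absorbs_sections_def
  proof (intro conjI ballI)
    show "finite (A \<inter> B)" "A \<inter> B \<subseteq> G"
      using A B by (auto simp: absorbs_sections_def)
  next
    fix g assume "g \<in> G"
    then obtain l l' where "\<forall>k\<ge>l. \<forall>v. length v = k \<longrightarrow> section_at g v \<in> A"
      and "\<forall>k\<ge>l'. \<forall>v. length v = k \<longrightarrow> section_at g v \<in> B"
      using A B unfolding absorbs_sections_def by meson
    then show "\<exists>l. \<forall>k\<ge>l. \<forall>v. length v = k \<longrightarrow> section_at g v \<in> A \<inter> B"
      by (intro exI[of _ "max l l'"]) auto
  qed
  obtain N0 where "?P N0"
    using assms unfolding contracting_def by blast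
  then obtain M where M: "?P M" "\<And>N. ?P N \<Longrightarrow> card M \<le> card N"
    using ex_has_least_nat[of ?P N0 card] by blast
  have least: "M \<subseteq> N" if "?P N" for N
  proof -
    have "card M \<le> card (M \<inter> N)"
      using M(2) Int[OF M(1) that] .
    moreover have "finite M"
      using M(1) by (simp add: absorbs_sections_def)
    ultimately have "M \<inter> N = M"
      by (meson card_seteq inf_le1)
    then show ?thesis by blast
  qed
  have "nucleus G = M"
    unfolding nucleus_def by (rule Least_equality) (use M(1) least in auto)
  then show "absorbs_sections G (nucleus G)" "absorbs_sections G N \<Longrightarrow> nucleus G \<subseteq> N"
    using M(1) least by auto
qed

lemma is_portrait_unique:
  "is_portrait N g s \<Longrightarrow> is_portrait N g t \<Longrightarrow> s = t"
proof (induction arbitrary: t rule: is_portrait.induct)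
  case (leaf g)
  from leaf(2) show ?case by cases (use leaf(1) in auto)
next
  case (node g c)
  from node.prems show ?case
  proof cases
    case (node c')
    then show ?thesis using node.IH by (auto intro!: ext)
  qed (use node.hyps in simp)
qed

lemma is_portrait_nucleus:
  assumes G: "contracting G" and g: "g \<in> G"
  shows "is_portrait (nucleus G) g (nucleus_portrait G g)"
proof -
  have "\<exists>t. is_portrait (nucleus G) h t"
    if "\<forall>v. length v = l \<longrightarrow> section_at h v \<in> nucleus G" for l h
    using that
  proof (induction l arbitrary: h)
    case 0
    then have "h \<in> nucleus G" by (simp add: section_at_def)
    then show ?case by (blast intro: is_portrait.leaf)
  next
    case (Suc l)
    have "\<exists>t. is_portrait (nucleus G) (section_at h [x]) t" for x
    proof (rule Suc.IH, intro allI impI)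
      fix v :: "'a list" assume "length v = l"
      moreover have "section_at (section_at h [x]) v = section_at h (x # v)"
        by (simp add: section_at_def fun_eq_iff drop_Suc drop_tl)
      ultimately show "section_at (section_at h [x]) v \<in> nucleus G"
        using Suc.prems by simp
    qed
    then obtain c where "\<And>x. is_portrait (nucleus G) (section_at h [x]) (c x)"
      by metis
    then show ?case
      by (cases "h \<in> nucleus G") (blast intro: is_portrait.intros)+
  qed
  moreover obtain l where "\<forall>v. length v = l \<longrightarrow> section_at g v \<in> nucleus G"
    using absorbs_nucleus(1)[OF G] g unfolding absorbs_sections_def by blast
  ultimately obtain t where "is_portrait (nucleus G) g t"
    by blast
  then show ?thesis
    unfolding nucleus_portrait_def by (metis is_portrait_unique the_equality)
qed

end

theory Submission
  imports Defs
begin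

text \<open>
  Let \<open>G\<close> be branching over \<open>K\<close>, let \<open>T\<close> be a finite set of representatives of the cosets of \<open>K\<close>,
  and let \<open>B\<close> be a finite set generating \<open>K\<close> as a monoid. Every \<open>g \<in> G\<close> is a product \<open>k t\<close> with
  \<open>t \<in> T\<close> and \<open>k\<close> a word over \<open>B\<close>. Given such factorizations \<open>k\<^sub>x t\<^sub>x\<close> of the sections \<open>g|\<^sub>x\<close>, we have
  \<open>g = (k\<^sub>x)\<^sub>x h\<close>, where \<open>(k\<^sub>x)\<^sub>x \<in> K\<close> because \<open>K\<^sup>d\<close> lies in the image of \<open>K\<close>, and \<open>h\<close> depends only on
  the finitely many data \<open>t\<^sub>x\<close> and the permutation at the root, so that it can be factorized by table
  lookup. The element of \<open>K\<close> with the single nontrivial section \<open>k\<^sub>x\<close> is obtained from \<open>k\<^sub>x\<close> by a fixed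
  substitution \<open>B \<rightarrow> B*\<close>. Hence one level of the portrait multiplies the length of the words by at
  most a constant. Finally, sections of products of two generators at a fixed level lie in the
  nucleus, hence in \<open>S\<close>, so passing to that level halves the length of a word: the portrait has
  depth \<open>O(log n)\<close>, and words, portrait and running time are polynomial in \<open>n\<close>.
\<close>

section \<open>Tree automorphisms as functions\<close>

lemma AutT_simps [simp]:
  "carrier AutT = tree_auts" "g \<otimes>\<^bsub>AutT\<^esub> h = h \<circ> g" "\<one>\<^bsub>AutT\<^esub> = id"
  by (simp_all add: AutT_def)

lemma word_value_simps [simp]:
  "word_value [] = id"
  "word_value (s # w) = word_value w \<circ> s"
  by (simp_all add: word_value_def)

lemma word_value_append: "word_value (u @ w) = word_value w \<circ> word_value u"
  by (induction u) (simp_all add: comp_assoc)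

lemma tree_aut_length: "g \<in> tree_auts \<Longrightarrow> length (g v) = length v"
proof (induction v rule: rev_induct)
  case Nil
  then show ?case by (simp add: tree_auts_def)
next
  case (snoc x v)
  then show ?case using tree_aut_snoc[OF snoc.prems, of v x] by auto
qed

lemma comp_tree_auts: "g \<in> tree_auts \<Longrightarrow> h \<in> tree_auts \<Longrightarrow> h \<circ> g \<in> tree_auts"
  using group.is_monoid[OF group_AutT, THEN monoid.m_closed, of g h] by simp

lemma section_at_comp:
  assumes "g \<in> tree_auts" "h \<in> tree_auts"
  shows "section_at (h \<circ> g) v = section_at h (g v) \<circ> section_at g v"
  by (rule section_at_unique[OF comp_tree_auts[OF assms]])
    (simp add: section_at_append[OF assms(1)] section_at_append[OF assms(2)])

lemma section_at_section_at: "section_at (section_at g v) w = section_at g (v @ w)"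
  by (simp add: section_at_def fun_eq_iff add.commute)

lemma section_at_Nil [simp]: "section_at g [] = g"
  by (simp add: section_at_def)

lemma self_similar_subset: "self_similar G \<Longrightarrow> g \<in> G \<Longrightarrow> g \<in> tree_auts"
  using subgroup.subset[of G AutT] by (auto simp: self_similar_def)

lemma self_similar_comp: "self_similar G \<Longrightarrow> g \<in> G \<Longrightarrow> h \<in> G \<Longrightarrow> h \<circ> g \<in> G"
  using subgroup.m_closed[of G AutT g h] by (simp add: self_similar_def)

lemma self_similar_id: "self_similar G \<Longrightarrow> id \<in> G"
  using subgroup.one_closed[of G AutT] by (simp add: self_similar_def)

lemma section_at_in: "self_similar G \<Longrightarrow> g \<in> G \<Longrightarrow> section_at g v \<in> G"
proof (induction v rule: rev_induct)
  case (snoc x v)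
  then show ?case
    unfolding section_at_section_at[symmetric] by (simp add: self_similar_def)
qed simp

lemma word_value_in: "self_similar G \<Longrightarrow> w \<in> lists G \<Longrightarrow> word_value w \<in> G"
  by (induction w rule: list.induct) (auto simp: self_similar_id intro: self_similar_comp)

text \<open>The wreath recursion read backwards: a root permutation \<open>\<sigma>\<close> with
  prescribed sections. It is total, so any table data can be grafted; the result need not lie in
  \<open>G\<close>.\<close>

definition graft :: "('x \<Rightarrow> 'x) \<Rightarrow> ('x \<Rightarrow> 'x list \<Rightarrow> 'x list) \<Rightarrow> 'x list \<Rightarrow> 'x list" where
  "graft \<sigma> f w = (case w of [] \<Rightarrow> [] | x # v \<Rightarrow> \<sigma> x # f x v)"

lemma graft_comp: "graft \<sigma> f \<circ> graft id k = graft \<sigma> (\<lambda>x. f x \<circ> k x)"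
  by (auto simp: graft_def fun_eq_iff split: list.splits)

lemma graft_id: "graft id (\<lambda>_. id) = id"
  by (auto simp: graft_def fun_eq_iff split: list.splits)

lemma graft_decomposition:
  assumes g: "g \<in> tree_auts"
  shows "g = graft (perm_at_root g) (\<lambda>x. section_at g [x])"
proof
  fix w
  show "g w = graft (perm_at_root g) (\<lambda>x. section_at g [x]) w"
  proof (cases w)
    case Nil
    then show ?thesis using g by (simp add: graft_def tree_auts_def)
  next
    case (Cons x v)
    have "g [x] = [perm_at_root g x]"
      using tree_aut_length[OF g, of "[x]"] by (auto simp: perm_at_root_def length_Suc_conv)
    then show ?thesis
      using section_at_append[OF g, of "[x]" v] Cons by (simp add: graft_def)
  qed
qed

section \<open>Schreier generators\<close>

text \<open>Schreier's argument: a representative is moved through a word letter by letter, each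
  letter \<open>s\<close> leaving behind a factor \<open>t \<otimes> s \<otimes> inv t'\<close> in
  \<open>K\<close>. As \<open>S\<close> generates without inverses, so does
  \<open>B\<close>.\<close>

lemma (in group) schreier_generators:
  assumes K: "subgroup K G" and fin: "finite (rcosets K)" "finite S" "S \<subseteq> carrier G"
    and gen: "\<And>g. g \<in> carrier G \<Longrightarrow> \<exists>w\<in>lists S. g = foldr (\<otimes>) w \<one>"
  obtains T B where "finite T" "T \<subseteq> carrier G" "finite B" "B \<subseteq> K"
    and "\<And>g. g \<in> carrier G \<Longrightarrow> \<exists>t\<in>T. \<exists>w\<in>lists B. g = foldr (\<otimes>) w \<one> \<otimes> t"
    and "\<And>g. g \<in> K \<Longrightarrow> \<exists>w\<in>lists B. g = foldr (\<otimes>) w \<one>"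
proof -
  have Kc: "K \<subseteq> carrier G"
    using K by (rule subgroup.subset)
  have "\<exists>t. t \<in> c \<and> t \<in> carrier G" if "c \<in> rcosets K" for c
    using that Kc subgroup.one_closed[OF K] by (fastforce simp: RCOSETS_def r_coset_def)
  then obtain rep where rep: "\<And>c. c \<in> rcosets K \<Longrightarrow> rep c \<in> c \<and> rep c \<in> carrier G"
    by metis
  \<comment> \<open>The representative chosen for \<open>K\<close> need not be
    \<open>\<one>\<close>, but \<open>move\<close> is to be started at \<open>\<one>\<close>; a
    second representative of the same coset does no harm.\<close>
  define T where "T = insert \<one> (rep ` (rcosets K))"
  have T: "finite T" "T \<subseteq> carrier G" "\<one> \<in> T"
    using fin rep by (auto simp: T_def)
  have coset: "\<exists>t\<in>T. g \<otimes> inv t \<in> K" if g: "g \<in> carrier G" for g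
  proof -
    have c: "K #> g \<in> rcosets K"
      using g Kc by (rule rcosetsI[rotated])
    then obtain k where k: "k \<in> K" "rep (K #> g) = k \<otimes> g"
      using rep by (force simp: r_coset_def)
    then have "g \<otimes> inv (rep (K #> g)) = inv k"
      using g Kc by (simp add: inv_mult_group subset_iff m_assoc[symmetric])
    then have "g \<otimes> inv (rep (K #> g)) \<in> K"
      using k subgroup.m_inv_closed[OF K] by simp
    then show ?thesis
      using c by (intro bexI[of _ "rep (K #> g)"]) (simp_all add: T_def)
  qed
  \<comment> \<open>\<open>K \<inter> T\<close> joins the Schreier generators because the
    representative left over from an element of \<open>K\<close> lies in \<open>K\<close> and must
    be available as a last letter.\<close>
  define B where "B = K \<inter> ((\<lambda>(t, s, t'). t \<otimes> s \<otimes> inv t') ` (T \<times> S \<times> T) \<union> T)"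
  have B: "finite B" "B \<subseteq> K"
    using T fin by (auto simp: B_def)
  have closed: "foldr (\<otimes>) w \<one> \<in> carrier G" if "w \<in> lists (carrier G)" for w
    using that by (induction w rule: list.induct) auto
  have Bc: "w \<in> lists (carrier G)" if "w \<in> lists B" for w
    using that B Kc by auto
  have move: "\<exists>u\<in>lists B. \<exists>t'\<in>T. t \<otimes> foldr (\<otimes>) w \<one> = foldr (\<otimes>) u \<one> \<otimes> t'"
    if "w \<in> lists S" "t \<in> T" for w t
    using that
  proof (induction w arbitrary: t rule: list.induct)
    case Nil
    then show ?case using T by (intro bexI[of _ "[]"] bexI[of _ t]) auto
  next
    case (Cons s w)
    have s: "s \<in> carrier G" "t \<in> carrier G" "foldr (\<otimes>) w \<one> \<in> carrier G"
      using Cons.prems fin(3) T closed[of w] by auto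
    obtain t1 where t1: "t1 \<in> T" "t \<otimes> s \<otimes> inv t1 \<in> K"
      using coset[of "t \<otimes> s"] s by auto
    then have b: "t \<otimes> s \<otimes> inv t1 \<in> B" and t1c: "t1 \<in> carrier G"
      using Cons.prems T by (force simp: B_def)+
    obtain u t' where u: "u \<in> lists B" "t' \<in> T" "t1 \<otimes> foldr (\<otimes>) w \<one> = foldr (\<otimes>) u \<one> \<otimes> t'"
      using Cons.IH[OF _ t1(1)] Cons.prems by auto
    have c: "foldr (\<otimes>) u \<one> \<in> carrier G" "t' \<in> carrier G"
      using closed Bc u T by auto
    have "t \<otimes> (s \<otimes> foldr (\<otimes>) w \<one>) = (t \<otimes> s \<otimes> inv t1) \<otimes> (t1 \<otimes> foldr (\<otimes>) w \<one>)"
      using s t1c by (simp add: m_assoc[symmetric]) (simp add: m_assoc)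
    also have "\<dots> = foldr (\<otimes>) ((t \<otimes> s \<otimes> inv t1) # u) \<one> \<otimes> t'"
      using s t1c c by (simp add: u(3) m_assoc)
    finally show ?case
      using b u by (intro bexI[of _ "(t \<otimes> s \<otimes> inv t1) # u"] bexI[of _ t']) auto
  qed
  have all: "\<exists>t\<in>T. \<exists>w\<in>lists B. g = foldr (\<otimes>) w \<one> \<otimes> t" if g: "g \<in> carrier G" for g
  proof -
    obtain w where "w \<in> lists S" "g = foldr (\<otimes>) w \<one>"
      using gen[OF g] by blast
    then show ?thesis
      using move[of w \<one>] T g by auto
  qed
  have prodK: "foldr (\<otimes>) w \<one> \<in> K" if "w \<in> lists B" for w
    using that B by (induction w rule: list.induct)
      (auto simp: subgroup.one_closed[OF K] intro: subgroup.m_closed[OF K])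
  have "\<exists>w\<in>lists B. g = foldr (\<otimes>) w \<one>" if g: "g \<in> K" for g
  proof -
    obtain t w where tw: "t \<in> T" "w \<in> lists B" "g = foldr (\<otimes>) w \<one> \<otimes> t"
      using all g Kc by blast
    have c: "foldr (\<otimes>) w \<one> \<in> carrier G" "t \<in> carrier G"
      using closed Bc tw T by auto
    then have "t = inv (foldr (\<otimes>) w \<one>) \<otimes> g"
      using tw by (simp add: m_assoc[symmetric])
    then have "t \<in> K"
      using prodK[OF tw(2)] g subgroup.m_closed[OF K] subgroup.m_inv_closed[OF K] by simp
    then have tB: "t \<in> B"
      using tw by (simp add: B_def)
    have "foldr (\<otimes>) (v @ [t]) \<one> = foldr (\<otimes>) v \<one> \<otimes> t" if "v \<in> lists (carrier G)" for v
      using that by (induction v rule: list.induct) (use c closed in \<open>auto simp: m_assoc\<close>)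
    then show ?thesis
      using tw tB Bc by (intro bexI[of _ "w @ [t]"]) auto
  qed
  then show ?thesis
    using that T B all by blast
qed

section \<open>Contraction\<close>

lemma uniform_absorption:
  assumes "absorbs_sections G N" "finite F" "F \<subseteq> G"
  shows "\<exists>l. \<forall>g\<in>F. \<forall>v. l \<le> length v \<longrightarrow> section_at g v \<in> N"
  using assms(2,3)
proof (induction F rule: finite_induct)
  case (insert g F)
  obtain l l' where "\<forall>h\<in>F. \<forall>v. l \<le> length v \<longrightarrow> section_at h v \<in> N"
    and "\<forall>k\<ge>l'. \<forall>v. length v = k \<longrightarrow> section_at g v \<in> N"
    using insert assms(1) unfolding absorbs_sections_def by blast
  then show ?case by (intro exI[of _ "max l l'"]) auto
qed simp

text \<open>Letters are taken in pairs. The section of a product at \<open>v\<close> is that of the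
  first pair at \<open>v\<close> followed by that of the rest at the image of \<open>v\<close>,
  which is as long as \<open>v\<close>; so each pair contributes one letter from
  \<open>N\<close>.\<close>

lemma halve_word:
  assumes G: "self_similar G" and S: "S \<subseteq> G"
    and l: "\<And>g v. g \<in> insert id (S \<union> {t \<circ> s |s t. s \<in> S \<and> t \<in> S}) \<Longrightarrow> l \<le> length v \<Longrightarrow> section_at g v \<in> N"
    and u: "u \<in> lists S" and v: "l \<le> length v"
  shows "\<exists>w\<in>lists N. word_value w = section_at (word_value u) v \<and> length w \<le> (length u + 1) div 2"
  using u v
proof (induction u arbitrary: v rule: induct_list012)
  case 1
  show ?case by (intro bexI[of _ "[]"]) (simp_all add: section_at_def fun_eq_iff)
next
  case (2 s)
  then show ?case using l[of s v] by (intro bexI[of _ "[section_at s v]"]) auto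
next
  case (3 s t u)
  have st: "s \<in> S" "t \<in> S" "u \<in> lists S"
    using 3 by auto
  have auts: "s \<in> tree_auts" "t \<in> tree_auts" "t \<circ> s \<in> tree_auts" "word_value u \<in> tree_auts"
    using st S G self_similar_subset[OF G] word_value_in[OF G, of u] self_similar_comp[OF G] by blast+
  have "l \<le> length ((t \<circ> s) v)"
    using 3 tree_aut_length[OF auts(3)] by simp
  then obtain w where w: "w \<in> lists N" "word_value w = section_at (word_value u) ((t \<circ> s) v)"
    "length w \<le> (length u + 1) div 2"
    using 3(1) st by blast
  have eq: "word_value (section_at (t \<circ> s) v # w) = section_at (word_value (s # t # u)) v"
    using section_at_comp[OF auts(3,4)] w(2) by (simp add: comp_assoc)
  have "section_at (t \<circ> s) v \<in> N"
    using l[of "t \<circ> s" v] st 3 by blast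
  then show ?case
    using w(1,3) by (intro bexI[of _ "section_at (t \<circ> s) v # w"] conjI eq) simp_all
qed

text \<open>Descending \<open>l\<close> levels halves the word, and \<open>N \<subseteq> S\<close>
  makes the shorter word eligible again. After \<open>m\<close> rounds at most one letter is left,
  which one more round absorbs: hence \<open>Suc m\<close>.\<close>

lemma logarithmic_absorption:
  assumes G: "self_similar G" and N: "absorbs_sections G N" and S: "finite S" "S \<subseteq> G" "N \<subseteq> S"
  obtains l where "\<And>m u v. u \<in> lists S \<Longrightarrow> length u \<le> 2 ^ m \<Longrightarrow> l * Suc m \<le> length v \<Longrightarrow>
    section_at (word_value u) v \<in> N"
proof -
  \<comment> \<open>\<open>id\<close> covers the empty word in the base case.\<close>
  let ?F = "insert id (S \<union> {t \<circ> s |s t. s \<in> S \<and> t \<in> S})"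
  have "finite ?F"
    using S finite_image_set2[of "\<lambda>s. s \<in> S" "\<lambda>t. t \<in> S" "\<lambda>s t. t \<circ> s"] by simp
  moreover have "?F \<subseteq> G"
    using S(2) self_similar_id[OF G] self_similar_comp[OF G] by blast
  ultimately obtain l where l: "\<And>g v. g \<in> ?F \<Longrightarrow> l \<le> length v \<Longrightarrow> section_at g v \<in> N"
    using uniform_absorption[OF N, of ?F] by blast
  have "section_at (word_value u) v \<in> N"
    if "u \<in> lists S" "length u \<le> 2 ^ m" "l * Suc m \<le> length v" for m u v
    using that
  proof (induction m arbitrary: u v)
    case 0
    then show ?case
      by (cases u) (auto intro!: l)
  next
    case (Suc m)
    let ?v = "take l v"
    have v: "length ?v = l" "l * Suc m \<le> length (drop l v)"
      using Suc.prems(3) by auto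
    then obtain w where w: "w \<in> lists N" "word_value w = section_at (word_value u) ?v"
      "length w \<le> (length u + 1) div 2"
      using halve_word[OF G S(2) l Suc.prems(1), where v = ?v] by auto
    have "section_at (word_value w) (drop l v) \<in> N"
    proof (rule Suc.IH)
      show "w \<in> lists S" using w S by auto
      \<comment> \<open>Rounding up costs nothing, as \<open>2 ^ Suc m\<close> is even.\<close>
      show "length w \<le> 2 ^ m" using w(3) Suc.prems(2) by simp
    qed (rule v(2))
    then show ?case
      by (simp add: w section_at_section_at)
  qed
  then show ?thesis
    using that by blast
qed

text \<open>Stands in for the logarithm: \<open>m\<close> counts halvings while \<open>2 ^ m\<close>
  stays linear in \<open>n\<close>. The summand 1 is there for \<open>n = 0\<close>.\<close>

lemma ex_power_of_two: "\<exists>m. n \<le> 2 ^ m \<and> 2 ^ m \<le> 2 * n + (1 :: nat)"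
proof (induction n)
  case 0
  show ?case by (rule exI[of _ 0]) simp
next
  case (Suc n)
  then obtain m where m: "n \<le> 2 ^ m" "2 ^ m \<le> 2 * n + (1 :: nat)"
    by blast
  show ?case
  proof (cases "n = 2 ^ m")
    case True
    then have "1 \<le> n" by simp
    then show ?thesis using True by (intro exI[of _ "Suc m"]) simp
  next
    case False
    then show ?thesis using m by (intro exI[of _ m]) auto
  qed
qed

lemma generate_word:
  assumes "\<forall>s\<in>S. inv\<^bsub>AutT\<^esub> s \<in> S" "g \<in> generate AutT S"
  shows "\<exists>w\<in>lists S. word_value w = g"
  using assms(2)
proof (induction rule: generate.induct)
  case one
  show ?case by (rule bexI[of _ "[]"]) auto
next
  case (incl h)
  then show ?case by (intro bexI[of _ "[h]"]) auto
next
  case (inv h)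
  then show ?case using assms(1) by (intro bexI[of _ "[inv\<^bsub>AutT\<^esub> h]"]) auto
next
  case (eng h1 h2)
  then obtain u w where "u \<in> lists S" "w \<in> lists S" "word_value u = h1" "word_value w = h2"
    by blast
  then show ?case by (intro bexI[of _ "u @ w"]) (auto simp: word_value_append)
qed

section \<open>Tapes as stacks\<close>

text \<open>
  A stack is accessed either with the head on the first free cell (for pushing) or on the topmost
  symbol (for popping). On the empty stack the two coincide, since truncated subtraction matches a
  left move in the leftmost cell; hence no bottom marker is needed, a blank being read instead.
\<close>

definition loose_end :: "('i, 'o) symbol list \<Rightarrow> ('i, 'o) tape" where
  "loose_end ss = (word_on_tape ss, length ss)"

definition on_top :: "('i, 'o) symbol list \<Rightarrow> ('i, 'o) tape" where
  "on_top ss = (word_on_tape ss, length ss - 1)"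

lemma loose_end_Nil: "loose_end [] = on_top []"
  by (simp add: loose_end_def on_top_def)

lemma read_tape_simps [simp]:
  "read_tape (loose_end ss) = Blank"
  "read_tape (on_top []) = Blank"
  "read_tape (on_top (ss @ [a])) = a"
  by (simp_all add: loose_end_def on_top_def word_on_tape_def)

lemma act_on_tape_simps [simp]:
  "act_on_tape (a, MRight) (loose_end ss) = loose_end (ss @ [a])"
  "act_on_tape (Blank, MLeft) (loose_end ss) = on_top ss"
  "act_on_tape (Blank, MLeft) (on_top (ss @ [a])) = on_top ss"
  "act_on_tape (a, MRight) (on_top (ss @ [a])) = loose_end (ss @ [a])"
  by (auto simp: loose_end_def on_top_def word_on_tape_def nth_append fun_eq_iff)

lemma act_on_tape_stay [simp]: "act_on_tape (read_tape t, MStay) t = t"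
  by (cases t) simp

lemma act_on_tape_stay_simps [simp]:
  "act_on_tape (Blank, MStay) (loose_end ss) = loose_end ss"
  "act_on_tape (Blank, MStay) (on_top []) = on_top []"
  "act_on_tape (a, MStay) (on_top (ss @ [a])) = on_top (ss @ [a])"
  using act_on_tape_stay[of "loose_end ss"] act_on_tape_stay[of "on_top []"]
    act_on_tape_stay[of "on_top (ss @ [a])"] by simp_all

section \<open>Machines with abstract states\<close>

type_synonym ('q, 'i, 'o) transition =
  "'q \<Rightarrow> ('i, 'o) symbol list \<Rightarrow> ('q \<times> (('i, 'o) symbol \<times> move) list) option"

definition step_of :: "('q, 'i, 'o) transition \<Rightarrow> 'q \<times> ('i, 'o) tape list \<Rightarrow> 'q \<times> ('i, 'o) tape list" where
  "step_of \<delta> c = (case \<delta> (fst c) (map read_tape (snd c)) of None \<Rightarrow> c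
     | Some (q', acts) \<Rightarrow> (q', map2 act_on_tape acts (snd c)))"

text \<open>Numbering the states of any finite transition table gives a machine, so states may carry
  structured data such as pending words. Closure is demanded on \<open>Q\<close> and
  \<open>\<Gamma>\<close> only; \<open>\<delta>\<close> may be arbitrary elsewhere.\<close>

lemma abstract_machine:
  fixes \<delta> :: "('q, 'i, 'o) transition"
  assumes Q: "finite Q" "q0 \<in> Q"
    and \<Gamma>: "finite \<Gamma>" "Blank \<in> \<Gamma>" "In ` A \<subseteq> \<Gamma>"
    and k: "2 \<le> k"
    and closed: "\<And>q as q' acts. q \<in> Q \<Longrightarrow> as \<in> lists \<Gamma> \<Longrightarrow> length as = k \<Longrightarrow>
      \<delta> q as = Some (q', acts) \<Longrightarrow> q' \<in> Q \<and> length acts = k \<and> fst ` set acts \<subseteq> \<Gamma>"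
  obtains M :: "('i, 'o) tm" where "turing_machine A M"
    and "\<And>u q tps w j t. \<lbrakk>u \<in> lists A;
       (step_of \<delta> ^^ j) (q0, (word_on_tape (map In u), 0) # replicate (k - 1) (word_on_tape [], 0)) = (q, tps);
       \<delta> q (map read_tape tps) = None; fst (tps ! 1) = word_on_tape (map Out w); j \<le> t\<rbrakk>
       \<Longrightarrow> computes_within M u w t"
proof -
  obtain h where h: "bij_betw h (Q - {q0}) {0..<card (Q - {q0})}"
    using ex_bij_betw_finite_nat[of "Q - {q0}"] Q by auto
  define enc where "enc q = (if q = q0 then 0 else Suc (h q))" for q
  define code where "code = inv_into Q enc"
  have card: "card Q = Suc (card (Q - {q0}))"
    using Q by (metis card.remove)
  have inj: "inj_on enc Q"
    using h by (auto simp: inj_on_def enc_def bij_betw_def)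
  have img: "enc ` Q = {..<card Q}"
  proof -
    have "enc ` Q = insert 0 (Suc ` (h ` (Q - {q0})))"
      using Q by (auto simp: enc_def image_iff)
    also have "\<dots> = {..<card Q}"
      unfolding bij_betw_imp_surj_on[OF h] card lessThan_Suc_eq_insert_0 atLeast0LessThan ..
    finally show ?thesis .
  qed
  have code: "code (enc q) = q" if "q \<in> Q" for q
    using that inj by (simp add: code_def)
  have code_in: "code n \<in> Q" if "n < card Q" for n
    using that img unfolding code_def by (metis inv_into_into lessThan_iff)
  define M :: "('i, 'o) tm" where "M = \<lparr>ntapes = k, nstates = card Q, symbols = \<Gamma>,
    delta = \<lambda>n as. map_option (\<lambda>(q, acts). (enc q, acts)) (\<delta> (code n) as)\<rparr>"
  have sel: "ntapes M = k" "nstates M = card Q" "symbols M = \<Gamma>"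
    "\<And>q as. delta M q as = map_option (\<lambda>(q, acts). (enc q, acts)) (\<delta> (code q) as)"
    by (simp_all add: M_def)
  have tm: "turing_machine A M"
  proof -
    have "q' < card Q \<and> length acts = k \<and> fst ` set acts \<subseteq> \<Gamma>"
      if q: "q < card Q" and as: "as \<in> lists \<Gamma>" "length as = k"
        and d: "map_option (\<lambda>(q, acts). (enc q, acts)) (\<delta> (code q) as) = Some (q', acts)"
      for q as q' acts
    proof -
      obtain r where r: "\<delta> (code q) as = Some (r, acts)" "q' = enc r"
        using d by auto
      then show ?thesis
        using closed[OF code_in[OF q] as r(1)] img by auto
    qed
    moreover have "0 < card Q"
      by (simp add: card)
    ultimately show ?thesis
      using \<Gamma> k unfolding turing_machine_def sel by blast
  qed
  \<comment> \<open>\<open>code\<close> inverts \<open>enc\<close> on \<open>Q\<close> only, and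
    \<open>closed\<close> speaks of symbols in \<open>\<Gamma>\<close> only; the simulation
    therefore carries both along as an invariant.\<close>
  define valid where "valid c \<longleftrightarrow> fst c \<in> Q \<and> length (snd c) = k \<and>
    (\<forall>tp\<in>set (snd c). range (fst tp) \<subseteq> \<Gamma>)" for c :: "'q \<times> ('i, 'o) tape list"
  have reads: "map read_tape (snd c) \<in> lists \<Gamma> \<and> length (map read_tape (snd c)) = k" if "valid c" for c
    using that by (fastforce simp: valid_def image_subset_iff)
  have valid_step: "valid (step_of \<delta> c)" if c: "valid c" for c
  proof (cases "\<delta> (fst c) (map read_tape (snd c))")
    case None
    then show ?thesis using c by (simp add: step_of_def)
  next
    case (Some r)
    obtain q' acts where r: "r = (q', acts)" by fastforce
    have *: "q' \<in> Q" "length acts = k" "fst ` set acts \<subseteq> \<Gamma>"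
      using closed[of "fst c" "map read_tape (snd c)" q' acts] reads[OF c] Some r c
      by (auto simp: valid_def)
    have "range (fst tp) \<subseteq> \<Gamma>" if tp: "tp \<in> set (map2 act_on_tape acts (snd c))" for tp
    proof -
      obtain a tp' where a: "(a, tp') \<in> set (zip acts (snd c))" "tp = act_on_tape a tp'"
        using tp by auto
      have "fst a \<in> \<Gamma>" "range (fst tp') \<subseteq> \<Gamma>"
        using *(3) c set_zip_leftD[OF a(1)] set_zip_rightD[OF a(1)] by (auto simp: valid_def)
      then show ?thesis
        using a(2) by (cases a; cases tp') auto
    qed
    then show ?thesis
      using * c Some r by (simp add: step_of_def valid_def)
  qed
  have sim: "tm_step M (enc (fst c), snd c) = (enc (fst (step_of \<delta> c)), snd (step_of \<delta> c))"
    if c: "valid c" for c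
  proof -
    have "code (enc (fst c)) = fst c"
      using c code by (auto simp: valid_def)
    then show ?thesis
      by (auto simp: tm_step_def action_def step_of_def M_def split: option.splits)
  qed
  have "computes_within M u w t"
    if u: "u \<in> lists A"
      and run: "(step_of \<delta> ^^ j) (q0, (word_on_tape (map In u), 0) # replicate (k - 1) (word_on_tape [], 0)) = (q, tps)"
      and halt: "\<delta> q (map read_tape tps) = None"
      and out: "fst (tps ! 1) = word_on_tape (map Out w)" and jt: "j \<le> t"
    for u q tps w j t
  proof -
    define c :: "'q \<times> ('i, 'o) tape list" where "c = (q0, (word_on_tape (map In u), 0) # replicate (k - 1) (word_on_tape [], 0 :: nat))"
    have v0: "valid c"
      using u Q k \<Gamma> by (auto simp: c_def valid_def word_on_tape_def)
    have "valid ((step_of \<delta> ^^ i) c) \<and> (tm_step M ^^ i) (initial_config M u)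
        = (enc (fst ((step_of \<delta> ^^ i) c)), snd ((step_of \<delta> ^^ i) c))" for i
    proof (induction i)
      case 0
      then show ?case using v0 by (simp add: c_def initial_config_def enc_def M_def)
    next
      case (Suc i)
      then show ?case using valid_step sim by auto
    qed
    from this[of j] have "q \<in> Q" and final: "(tm_step M ^^ j) (initial_config M u) = (enc q, tps)"
      using run[folded c_def] by (auto simp: valid_def)
    then have act: "action M (enc q, tps) = None"
      using halt code by (simp add: action_def M_def)
    then have halted: "tm_step M (enc q, tps) = (enc q, tps)"
      by (simp add: tm_step_def)
    \<comment> \<open>\<open>computes_within\<close> inspects the configuration after exactly
      \<open>t\<close> steps; the halted configuration is a fixed point and fills the gap from
      \<open>j\<close> to \<open>t\<close>.\<close>
    have "(tm_step M ^^ i) (enc q, tps) = (enc q, tps)" for i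
      by (induction i) (simp_all add: halted)
    then have "(tm_step M ^^ t) (initial_config M u) = (enc q, tps)"
      using final jt funpow_add[of "t - j" j "tm_step M"] by simp
    then show ?thesis
      using act out by (simp add: computes_within_def)
  qed
  then show ?thesis
    using that tm by blast
qed

text \<open>\<open>k\<close> is only an upper bound, so that estimates can be added and weakened
  along a run.\<close>

definition reaches :: "('q, 'i, 'o) transition \<Rightarrow> nat \<Rightarrow> 'q \<times> ('i, 'o) tape list \<Rightarrow> 'q \<times> ('i, 'o) tape list \<Rightarrow> bool" where
  "reaches \<delta> k c c' \<longleftrightarrow> (\<exists>j\<le>k. (step_of \<delta> ^^ j) c = c')"

lemma reaches_refl: "reaches \<delta> k c c"
  by (auto simp: reaches_def intro!: exI[of _ 0])

lemma reaches_mono: "reaches \<delta> k c c' \<Longrightarrow> k \<le> k' \<Longrightarrow> reaches \<delta> k' c c'"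
  unfolding reaches_def using order_trans by blast

lemma reaches_trans:
  assumes "reaches \<delta> a c c'" "reaches \<delta> b c' c''"
  shows "reaches \<delta> (a + b) c c''"
proof -
  obtain i j where ij: "i \<le> a" "j \<le> b" "(step_of \<delta> ^^ i) c = c'" "(step_of \<delta> ^^ j) c' = c''"
    using assms by (auto simp: reaches_def)
  then have "(step_of \<delta> ^^ (j + i)) c = c''"
    by (simp add: funpow_add)
  then show ?thesis
    unfolding reaches_def using ij by (intro exI[of _ "j + i"]) simp
qed

lemma reaches_step: "reaches \<delta> k (step_of \<delta> c) c' \<Longrightarrow> reaches \<delta> (Suc k) c c'"
  unfolding reaches_def by (metis Suc_le_mono funpow_Suc_right comp_apply)

section \<open>The shift-reduce machine\<close>

text \<open>\<open>h\<close> bounds the depth without being equal to it, so the children of a vertex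
  share one \<open>h\<close> although their depths differ.\<close>

inductive shallow :: "'g set \<Rightarrow> nat \<Rightarrow> ('x, 'g) portrait \<Rightarrow> bool" for A where
  "g \<in> A \<Longrightarrow> shallow A h (Leaf g)"
| "(\<And>x. shallow A h (c x)) \<Longrightarrow> shallow A (Suc h) (Node \<sigma> c)"

lemma map2_map_self: "map2 f ys (map g ys) = map (\<lambda>x. f x (g x)) ys"
  by (induction ys) auto

type_synonym 'x aut = "'x list \<Rightarrow> 'x list"

text \<open>Words still to be written are kept in the control; tables of bounded entries keep the
  state set finite. \<open>Write\<close>, \<open>Mark\<close> and \<open>Transfer\<close> in turn
  complete the scratch word, push the marker and move the word on top of it.\<close>

datatype 'x control = Scan | Main | Reduce "'x \<Rightarrow> 'x" "'x aut list" "'x aut list"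
  | Write "'x aut" "'x aut list" | Mark "'x aut" | Transfer | Emit "'x aut list"

text \<open>
  An item \<open>(t, w)\<close> stands for the element \<open>t \<circ> word_value w\<close> with \<open>t \<in> T\<close> and \<open>w\<close> a word over \<open>B\<close>.
  The tables \<open>leaf_item\<close> and \<open>node_item\<close> supply the factorizations at a leaf and at a vertex whose
  children have the given markers in \<open>T\<close>; \<open>lift x\<close> is the substitution moving an element to the
  section at \<open>x\<close>, and \<open>spell\<close> rewrites elements in the generators \<open>S\<close>.
\<close>

locale portrait_transducer =
  fixes xs :: "'x::finite list"
    and A T B S :: "'x aut set"
    and leaf_item :: "'x aut \<Rightarrow> 'x aut \<times> 'x aut list"
    and node_item :: "('x \<Rightarrow> 'x) \<Rightarrow> 'x aut list \<Rightarrow> 'x aut \<times> 'x aut list"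
    and lift :: "'x \<Rightarrow> 'x aut \<Rightarrow> 'x aut list"
    and spell :: "'x aut \<Rightarrow> 'x aut list"
    and L :: nat
  assumes xs: "xs \<noteq> []" "set xs = UNIV"
    and finite_sets: "finite A" "finite T" "finite B" "finite S"
    and leaf_item: "g \<in> A \<union> T \<Longrightarrow> fst (leaf_item g) \<in> T \<and>
      snd (leaf_item g) \<in> lists B \<and> length (snd (leaf_item g)) \<le> L"
    and node_item: "ts \<in> lists T \<Longrightarrow> length ts = length xs \<Longrightarrow> fst (node_item \<sigma> ts) \<in> T \<and>
      snd (node_item \<sigma> ts) \<in> lists B \<and> length (snd (node_item \<sigma> ts)) \<le> L"
    and lift: "b \<in> B \<Longrightarrow> lift x b \<in> lists B \<and> length (lift x b) \<le> L"
    and spell: "g \<in> B \<union> T \<Longrightarrow> spell g \<in> lists S \<and> length (spell g) \<le> L"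
begin

text \<open>
  Tapes \<open>2\<close> and \<open>3\<close> are the stack and a scratch tape. The input is consumed from right to left: the
  reversed preorder is a postorder in which the first child of a vertex comes last, so its item is on
  top of the stack when the vertex is reduced. An item \<open>(t, w)\<close> is stored as the marker \<open>In (Inl t)\<close>
  below the reversed word \<open>w\<close>, and popping it yields \<open>w\<close> in the right order. In \<open>Reduce \<sigma> ts p\<close>
  the list \<open>ts\<close> holds the markers of the children already popped, and \<open>p\<close> has yet to be written.
\<close>

fun control_step :: "('x control, 'x label, 'x aut) transition" where
  "control_step Scan [a, r, s, t] = Some (if a = Blank then (Main, [(Blank, MLeft), (r, MStay), (s, MStay), (t, MStay)])
     else (Scan, [(a, MRight), (r, MStay), (s, MStay), (t, MStay)]))"
| "control_step Main [a, r, s, t] = Some (case a of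
     In (Inl g) \<Rightarrow> (Write (fst (leaf_item g)) (snd (leaf_item g)),
       [(Blank, MLeft), (r, MStay), (Blank, MLeft), (t, MStay)])
   | In (Inr \<sigma>) \<Rightarrow> (Reduce \<sigma> [] [], [(Blank, MLeft), (r, MStay), (Blank, MLeft), (t, MStay)])
   | _ \<Rightarrow> (Emit [], [(a, MStay), (r, MStay), (Blank, MLeft), (t, MStay)]))"
| "control_step (Reduce \<sigma> ts (p # ps)) [a, r, s, t] =
     Some (Reduce \<sigma> ts ps, [(a, MStay), (r, MStay), (s, MStay), (Out p, MRight)])"
| "control_step (Reduce \<sigma> ts []) [a, r, s, t] = (case s of
     Out b \<Rightarrow> if b \<in> B then Some (Reduce \<sigma> ts (lift (xs ! length ts) b),
       [(a, MStay), (r, MStay), (Blank, MLeft), (t, MStay)]) else None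
   | In (Inl m) \<Rightarrow> if m \<in> T then Some (if Suc (length ts) < length xs then Reduce \<sigma> (ts @ [m]) []
         else Write (fst (node_item \<sigma> (ts @ [m]))) (snd (node_item \<sigma> (ts @ [m]))),
       [(a, MStay), (r, MStay), (Blank, MLeft), (t, MStay)]) else None
   | _ \<Rightarrow> None)"
| "control_step (Write m (p # ps)) [a, r, s, t] =
     Some (Write m ps, [(a, MStay), (r, MStay), (s, MStay), (Out p, MRight)])"
| "control_step (Write m []) [a, r, s, t] = Some (Mark m,
     [(a, MStay), (r, MStay), (s, if s = Blank then MStay else MRight), (Blank, MLeft)])"
| "control_step (Mark m) [a, r, s, t] =
     Some (Transfer, [(a, MStay), (r, MStay), (In (Inl m), MRight), (t, MStay)])"
| "control_step Transfer [a, r, s, t] = Some (case t of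
     Out b \<Rightarrow> (Transfer, [(a, MStay), (r, MStay), (t, MRight), (Blank, MLeft)])
   | _ \<Rightarrow> (Main, [(a, MStay), (r, MStay), (s, MStay), (t, MStay)]))"
| "control_step (Emit (p # ps)) [a, r, s, t] =
     Some (Emit ps, [(a, MStay), (Out p, MRight), (s, MStay), (t, MStay)])"
| "control_step (Emit []) [a, r, s, t] = (case s of
     Out b \<Rightarrow> if b \<in> B then Some (Emit (spell b),
       [(a, MStay), (r, MStay), (Blank, MLeft), (t, MStay)]) else None
   | In (Inl m) \<Rightarrow> if m \<in> T then Some (Emit (spell m),
       [(a, MStay), (r, MStay), (Blank, MLeft), (t, MStay)]) else None
   | _ \<Rightarrow> None)"
| "control_step _ _ = None"

definition states :: "'x control set" where
  "states = {Scan, Main, Transfer} \<union>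
     {Reduce \<sigma> ts p |\<sigma> ts p. ts \<in> lists T \<and> length ts < length xs \<and> p \<in> lists B \<and> length p \<le> L} \<union>
     {Write t p |t p. t \<in> T \<and> p \<in> lists B \<and> length p \<le> L} \<union>
     {Mark t |t. t \<in> T} \<union> {Emit p |p. p \<in> lists S \<and> length p \<le> L}"

definition syms :: "('x label, 'x aut) symbol set" where
  "syms = {Blank} \<union> In ` (Inl ` (A \<union> T) \<union> range Inr) \<union> Out ` (B \<union> S)"

lemma finite_states: "finite states"
proof -
  have fin: "finite {p. p \<in> lists C \<and> length p \<le> n}" if "finite C" for C :: "'x aut set" and n
    by (rule finite_subset[OF _ finite_lists_length_le[OF that, of n]]) auto
  have T: "finite {p. p \<in> lists T \<and> length p < length xs}"
    by (rule finite_subset[OF _ fin[OF finite_sets(2), of "length xs"]]) auto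
  have "states \<subseteq> {Scan, Main, Transfer} \<union> (\<lambda>(\<sigma>, ts, p). Reduce \<sigma> ts p) `
       (UNIV \<times> {p. p \<in> lists T \<and> length p < length xs} \<times> {p. p \<in> lists B \<and> length p \<le> L}) \<union>
     (\<lambda>(t, p). Write t p) ` (T \<times> {p. p \<in> lists B \<and> length p \<le> L}) \<union>
     Mark ` T \<union> Emit ` {p. p \<in> lists S \<and> length p \<le> L}"
    unfolding states_def by (intro Un_mono) (force simp: image_iff)+
  then show ?thesis
    by (rule finite_subset) (use fin T finite_sets in \<open>intro finite_UnI finite_imageI finite_cartesian_product; simp\<close>)
qed

lemma finite_syms: "finite syms"
  using finite_sets by (simp add: syms_def)

lemma trans_closed:
  assumes "q \<in> states" "as \<in> lists syms" "length as = 4" "control_step q as = Some (q', acts)"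
  shows "q' \<in> states \<and> length acts = 4 \<and> fst ` set acts \<subseteq> syms"
proof -
  obtain a r s t where as: "as = [a, r, s, t]"
    using assms(3) by (auto simp: numeral_eq_Suc length_Suc_conv)
  have sy: "a \<in> syms" "r \<in> syms" "s \<in> syms" "t \<in> syms" "Blank \<in> syms"
    using assms(2) by (auto simp: as syms_def)
  have xs0: "0 < length xs" using xs by simp
  have memT: "In (Inl m) \<in> syms" if "m \<in> T" for m using that by (auto simp: syms_def)
  have memO: "Out p \<in> syms" if "p \<in> B \<union> S" for p using that by (auto simp: syms_def)
  \<comment> \<open>Markers and leaf labels share the symbols \<open>In (Inl m)\<close>, so
    membership in \<open>syms\<close> alone cannot exclude a marker on the input tape; hence
    \<open>leaf_item\<close> covers \<open>A \<union> T\<close>.\<close>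
  have memA: "m \<in> A \<union> T" if "In (Inl m) \<in> syms" for m using that by (auto simp: syms_def)
  show ?thesis
  proof (cases q)
    case Scan
    then show ?thesis using assms(4) sy by (auto simp: as states_def split: if_splits)
  next
    case Main
    then show ?thesis using assms(4) sy leaf_item xs0 memA
      by (auto simp: as states_def split: symbol.splits sum.splits)
  next
    case (Reduce \<sigma> ts p)
    then have st: "ts \<in> lists T" "length ts < length xs" "p \<in> lists B" "length p \<le> L"
      using assms(1) by (auto simp: states_def)
    show ?thesis
    proof (cases p)
      case (Cons a list)
      then show ?thesis using assms(4) sy st memO Reduce by (auto simp: as states_def)
    next
      case Nil
      show ?thesis
      proof (cases "Suc (length ts) < length xs")
        case True
        then show ?thesis using assms(4) sy st lift Reduce Nil
          by (auto simp: as states_def split: symbol.splits sum.splits if_splits)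
      next
        case False
        \<comment> \<open>The marker popped now is that of the last child, so the list is complete,
          as \<open>node_item\<close> requires.\<close>
        then have "Suc (length ts) = length xs" using st by simp
        then show ?thesis using assms(4) sy st lift node_item[of "ts @ _"] Reduce Nil
          by (auto simp: as states_def split: symbol.splits sum.splits if_splits)
      qed
    qed
  next
    case (Write m p)
    then show ?thesis using assms(1,4) sy memO by (cases p) (auto simp: as states_def)
  next
    case (Mark m)
    then show ?thesis using assms(1,4) sy memT by (auto simp: as states_def)
  next
    case Transfer
    then show ?thesis using assms(4) sy by (auto simp: as states_def split: symbol.splits)
  next
    case (Emit p)
    show ?thesis
    proof (cases p)
      case Nil
      then show ?thesis using assms(4) Emit sy spell
        by (auto simp: as states_def split: symbol.splits sum.splits if_splits)
    next
      case (Cons a list)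
      then show ?thesis using assms(1,4) Emit sy memO by (auto simp: as states_def)
    qed
  qed
qed

definition item :: "'x aut \<times> 'x aut list \<Rightarrow> ('x label, 'x aut) symbol list" where
  "item p = In (Inl (fst p)) # rev (map Out (snd p))"

text \<open>What the machine computes, as a recursion on portraits. The lifted words come first
  because products act from left to right: the kernel part precedes the table entry.\<close>

primrec collapse :: "('x, 'x aut) portrait \<Rightarrow> 'x aut \<times> 'x aut list" where
  "collapse (Leaf g) = leaf_item g"
| "collapse (Node \<sigma> c) = (let ps = map (\<lambda>x. collapse (c x)) xs; n = node_item \<sigma> (map fst ps)
     in (fst n, concat (map2 (\<lambda>x p. concat (map (lift x) (snd p))) xs ps) @ snd n))"

lemma collapse_closed:
  "shallow A h p \<Longrightarrow> fst (collapse p) \<in> T \<and> snd (collapse p) \<in> lists B"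
proof (induction rule: shallow.induct)
  case (1 g h)
  then show ?case using leaf_item[of g] by simp
next
  case (2 h c \<sigma>)
  have "map fst (map (\<lambda>x. collapse (c x)) xs) \<in> lists T"
    using 2 by (auto simp: in_lists_conv_set)
  moreover have "u \<in> B" if "(x, y) \<in> set (zip xs (map (\<lambda>x. collapse (c x)) xs))" "b \<in> set (snd y)"
    "u \<in> set (lift x b)" for x y b u
  proof -
    have "y \<in> set (map (\<lambda>x. collapse (c x)) xs)"
      using that(1) by (rule set_zip_rightD)
    then have "b \<in> B" using 2 that(2) by auto
    then show ?thesis using lift[of b x] that(3) by (auto simp: in_lists_conv_set)
  qed
  ultimately show ?case
    using node_item[of "map fst (map (\<lambda>x. collapse (c x)) xs)" \<sigma>]
    by (auto simp: Let_def in_lists_conv_set)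
qed

section \<open>Runs of the machine and their step counts\<close>

lemma run_reduce_pending:
  "reaches control_step (length p) (Reduce \<sigma> ts p, [a, r, on_top z, loose_end y])
     (Reduce \<sigma> ts [], [a, r, on_top z, loose_end (y @ map Out p)])"
proof (induction p arbitrary: y)
  case Nil
  then show ?case by (simp add: reaches_refl)
next
  case (Cons b p)
  have "step_of control_step (Reduce \<sigma> ts (b # p), [a, r, on_top z, loose_end y])
     = (Reduce \<sigma> ts p, [a, r, on_top z, loose_end (y @ [Out b])])"
    by (simp add: step_of_def)
  then show ?case
    using Cons[of "y @ [Out b]"] by (auto intro: reaches_step)
qed

text \<open>One pop and at most \<open>L\<close> writes per letter give the factor
  \<open>L + 1\<close>. The pending word \<open>p\<close> is general because popping a letter leaves
  its substitute pending.\<close>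

lemma run_reduce_letters:
  assumes "w \<in> lists B"
  shows "reaches control_step (length p + (L + 1) * length w)
     (Reduce \<sigma> ts p, [a, r, on_top (z @ rev (map Out w)), loose_end y])
     (Reduce \<sigma> ts [], [a, r, on_top z,
        loose_end (y @ map Out (p @ concat (map (lift (xs ! length ts)) w)))])"
  using assms
proof (induction w arbitrary: p y rule: list.induct)
  case Nil
  then show ?case using run_reduce_pending[of p] by simp
next
  case (Cons b w)
  let ?l = "lift (xs ! length ts)"
  have len: "length (?l b) \<le> L" using lift[of b] Cons.prems by simp
  have "step_of control_step (Reduce \<sigma> ts [], [a, r, on_top ((z @ rev (map Out w)) @ [Out b]), loose_end (y @ map Out p)])
     = (Reduce \<sigma> ts (?l b), [a, r, on_top (z @ rev (map Out w)), loose_end (y @ map Out p)])"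
    using Cons.prems by (simp add: step_of_def del: append_assoc)
  moreover have "reaches control_step (length (?l b) + (L + 1) * length w)
      (Reduce \<sigma> ts (?l b), [a, r, on_top (z @ rev (map Out w)), loose_end (y @ map Out p)])
      (Reduce \<sigma> ts [], [a, r, on_top z, loose_end ((y @ map Out p) @ map Out (?l b @ concat (map ?l w)))])"
    by (intro Cons.IH) (use Cons.prems in simp)
  ultimately have "reaches control_step (Suc (length (?l b) + (L + 1) * length w))
      (Reduce \<sigma> ts [], [a, r, on_top (z @ rev (map Out (b # w))), loose_end (y @ map Out p)])
      (Reduce \<sigma> ts [], [a, r, on_top z, loose_end (y @ map Out (p @ concat (map ?l (b # w))))])"
    by (auto intro: reaches_step)
  from reaches_trans[OF run_reduce_pending this] show ?case
    by (rule reaches_mono) (use len in simp)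
qed

lemma run_reduce_item:
  assumes "snd p \<in> lists B" "fst p \<in> T"
  shows "reaches control_step ((L + 1) * length (snd p) + 1)
     (Reduce \<sigma> ts [], [a, r, on_top (z @ item p), loose_end y])
     (if Suc (length ts) < length xs then Reduce \<sigma> (ts @ [fst p]) []
      else Write (fst (node_item \<sigma> (ts @ [fst p]))) (snd (node_item \<sigma> (ts @ [fst p]))),
      [a, r, on_top z, loose_end (y @ map Out (concat (map (lift (xs ! length ts)) (snd p))))])"
proof -
  have "reaches control_step (Suc 0) (Reduce \<sigma> ts [], [a, r, on_top (z @ [In (Inl (fst p))]), loose_end y'])
     (if Suc (length ts) < length xs then Reduce \<sigma> (ts @ [fst p]) []
      else Write (fst (node_item \<sigma> (ts @ [fst p]))) (snd (node_item \<sigma> (ts @ [fst p]))),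
      [a, r, on_top z, loose_end y'])" for y'
    using assms by (intro reaches_step) (simp add: step_of_def reaches_refl)
  from reaches_trans[OF run_reduce_letters[OF assms(1), of "[]" \<sigma> ts a r "z @ [In (Inl (fst p))]" y] this]
  show ?thesis by (simp add: item_def)
qed

text \<open>Items are stacked in reverse, so the first child is popped first, and
  \<open>length ts\<close> is the index in \<open>xs\<close> of the letter being lifted.\<close>

lemma run_reduce_items:
  assumes "ps \<noteq> []" "length ts + length ps = length xs"
    and "\<And>p. p \<in> set ps \<Longrightarrow> snd p \<in> lists B \<and> fst p \<in> T"
  shows "reaches control_step (\<Sum>p\<leftarrow>ps. (L + 1) * length (snd p) + 1)
     (Reduce \<sigma> ts [], [a, r, on_top (z @ concat (map item (rev ps))), loose_end y])
     (Write (fst (node_item \<sigma> (ts @ map fst ps))) (snd (node_item \<sigma> (ts @ map fst ps))),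
      [a, r, on_top z, loose_end (y @ map Out
         (concat (map2 (\<lambda>x p. concat (map (lift x) (snd p))) (drop (length ts) xs) ps)))])"
  using assms
proof (induction ps arbitrary: ts y)
  case Nil
  then show ?case by simp
next
  case (Cons p ps)
  let ?o = "map Out (concat (map (lift (xs ! length ts)) (snd p)))"
  have drop: "drop (length ts) xs = xs ! length ts # drop (Suc (length ts)) xs"
    using Cons.prems(2) by (simp add: Cons_nth_drop_Suc)
  have 1: "reaches control_step ((L + 1) * length (snd p) + 1)
     (Reduce \<sigma> ts [], [a, r, on_top ((z @ concat (map item (rev ps))) @ item p), loose_end y])
     (if Suc (length ts) < length xs then Reduce \<sigma> (ts @ [fst p]) []
      else Write (fst (node_item \<sigma> (ts @ [fst p]))) (snd (node_item \<sigma> (ts @ [fst p]))),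
      [a, r, on_top (z @ concat (map item (rev ps))), loose_end (y @ ?o)])"
    using Cons.prems(3)[of p] by (intro run_reduce_item) auto
  show ?case
  proof (cases "ps = []")
    case True
    then show ?thesis using 1 Cons.prems(2) drop by simp
  next
    case False
    then have more: "Suc (length ts) < length xs"
      using Cons.prems(2) by (cases ps) auto
    have "reaches control_step (\<Sum>p\<leftarrow>ps. (L + 1) * length (snd p) + 1)
     (Reduce \<sigma> (ts @ [fst p]) [], [a, r, on_top (z @ concat (map item (rev ps))), loose_end (y @ ?o)])
     (Write (fst (node_item \<sigma> ((ts @ [fst p]) @ map fst ps))) (snd (node_item \<sigma> ((ts @ [fst p]) @ map fst ps))),
      [a, r, on_top z, loose_end ((y @ ?o) @ map Out
         (concat (map2 (\<lambda>x p. concat (map (lift x) (snd p))) (drop (length (ts @ [fst p])) xs) ps)))])"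
      using Cons.prems False by (intro Cons.IH) auto
    with 1 more show ?thesis
      using reaches_trans by (fastforce simp: drop)
  qed
qed

text \<open>Popping the scratch word reverses it, which is the order that \<open>item\<close> wants:
  first letter on top.\<close>

lemma run_transfer:
  "reaches control_step (length w + 1)
     (Transfer, [a, r, loose_end z, on_top (map Out w)])
     (Main, [a, r, loose_end (z @ rev (map Out w)), loose_end []])"
proof (induction w arbitrary: z rule: rev_induct)
  case Nil
  have "step_of control_step (Transfer, [a, r, loose_end z, on_top []]) = (Main, [a, r, loose_end z, on_top []])"
    by (simp add: step_of_def)
  then show ?case
    using reaches_step[of control_step 0] by (simp add: loose_end_Nil reaches_refl)
next
  case (snoc b w)
  have "step_of control_step (Transfer, [a, r, loose_end z, on_top (map Out w @ [Out b])])
     = (Transfer, [a, r, loose_end (z @ [Out b]), on_top (map Out w)])"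
    by (simp add: step_of_def)
  then show ?case
    using snoc[of "z @ [Out b]"] by (auto intro: reaches_step)
qed

text \<open>An empty stack is recognized by reading a blank. The test decides whether the head must
  move right to the free cell, and it is reliable only for a stack without blanks.\<close>

lemma step_turn:
  "step_of control_step (Write m [], [a, r, on_top z, loose_end y])
     = (Mark m, [a, r, loose_end z, on_top y])" if "Blank \<notin> set z"
proof (cases z rule: rev_exhaust)
  case Nil
  then show ?thesis by (simp add: step_of_def loose_end_Nil)
next
  case (snoc z' s)
  then show ?thesis using that by (auto simp: step_of_def)
qed

text \<open>\<open>y\<close> is what a reduction has left on the scratch tape. The count consists of
  writing \<open>w\<close>, two steps for turning and marking, and the transfer with its final
  blank.\<close>

lemma run_write:
  assumes "Blank \<notin> set z"
  shows "reaches control_step (length w + (2 + (length (y @ w) + 1)))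
     (Write m w, [a, r, on_top z, loose_end (map Out y)])
     (Main, [a, r, loose_end (z @ item (m, y @ w)), loose_end []])"
proof -
  have 1: "reaches control_step (length w) (Write m w, [a, r, on_top z, loose_end y'])
     (Write m [], [a, r, on_top z, loose_end (y' @ map Out w)])" for y'
  proof (induction w arbitrary: y')
    case (Cons b w)
    have "step_of control_step (Write m (b # w), [a, r, on_top z, loose_end y'])
       = (Write m w, [a, r, on_top z, loose_end (y' @ [Out b])])"
      by (simp add: step_of_def)
    then show ?case
      using Cons[of "y' @ [Out b]"] by (auto intro: reaches_step)
  qed (simp add: reaches_refl)
  have "step_of control_step (Mark m, [a, r, loose_end z, on_top y']) =
      (Transfer, [a, r, loose_end (z @ [In (Inl m)]), on_top y'])" for y'
    by (cases y' rule: rev_exhaust) (auto simp: step_of_def)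
  then have "reaches control_step (Suc (Suc (length (y @ w) + 1)))
     (Write m [], [a, r, on_top z, loose_end (map Out y @ map Out w)])
     (Main, [a, r, loose_end ((z @ [In (Inl m)]) @ rev (map Out (y @ w))), loose_end []])"
    using run_transfer[of "y @ w" a r "z @ [In (Inl m)]"]
    by (intro reaches_step) (simp add: step_turn[OF assms] del: append_assoc rev_map)
  from reaches_trans[OF 1 this] show ?thesis
    by (simp add: item_def)
qed

text \<open>The 4 stands for reading the label, turning, marking and ending the transfer. Letters
  are charged twice, for writing and for transfer; at a vertex this is generous, as the reduction
  has already paid for writing the lifted letters.\<close>

primrec cost :: "('x, 'x aut) portrait \<Rightarrow> nat" where
  "cost (Leaf g) = 4 + 2 * length (snd (leaf_item g))"
| "cost (Node \<sigma> c) = (\<Sum>x\<leftarrow>xs. cost (c x)) + 4 +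
     (\<Sum>x\<leftarrow>xs. (L + 1) * length (snd (collapse (c x))) + 1) + 2 * length (snd (collapse (Node \<sigma> c)))"

lemma Blank_not_in_item: "Blank \<notin> set (item p)"
  by (auto simp: item_def)

text \<open>\<open>v\<close> is input still unread and \<open>z\<close> the stack below; with both
  general, subtrees can be processed one after another.\<close>

lemma run_portrait:
  assumes "shallow A h p" "Blank \<notin> set z"
  shows "reaches control_step (cost p)
     (Main, [on_top (map In (v @ encode_portrait xs p)), r, loose_end z, loose_end []])
     (Main, [on_top (map In v), r, loose_end (z @ item (collapse p)), loose_end []])"
  using assms
proof (induction arbitrary: v z rule: shallow.induct)
  case (1 g h)
  have "step_of control_step (Main, [on_top (map In v @ [In (Inl g)]), r, loose_end z, loose_end []])
    = (Write (fst (leaf_item g)) (snd (leaf_item g)), [on_top (map In v), r, on_top z, loose_end (map Out [])])"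
    by (simp add: step_of_def)
  then have "reaches control_step (Suc (length (snd (leaf_item g)) + (2 + (length ([] @ snd (leaf_item g)) + 1))))
     (Main, [on_top (map In v @ [In (Inl g)]), r, loose_end z, loose_end []])
     (Main, [on_top (map In v), r, loose_end (z @ item (fst (leaf_item g), [] @ snd (leaf_item g))), loose_end []])"
    using run_write[OF 1(2), of "snd (leaf_item g)" "[]" "fst (leaf_item g)" "on_top (map In v)" r]
    by (intro reaches_step) simp
  moreover have "Suc (length (snd (leaf_item g)) + (2 + (length ([] @ snd (leaf_item g)) + 1))) = cost (Leaf g)"
    by simp
  ultimately have "reaches control_step (cost (Leaf g))
     (Main, [on_top (map In v @ [In (Inl g)]), r, loose_end z, loose_end []])
     (Main, [on_top (map In v), r, loose_end (z @ item (fst (leaf_item g), [] @ snd (leaf_item g))), loose_end []])"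
    by argo
  then show ?case by (simp del: cost.simps)
next
  case (2 h c \<sigma>)
  let ?it = "\<lambda>x. collapse (c x)"
  \<comment> \<open>The input is read from right to left, so the tail of \<open>ys\<close> is
    consumed before its head and the head's item ends up on top.\<close>
  have children: "reaches control_step (\<Sum>x\<leftarrow>ys. cost (c x))
     (Main, [on_top (map In (v @ concat (map (\<lambda>x. encode_portrait xs (c x)) ys))), r, loose_end z, loose_end []])
     (Main, [on_top (map In v), r, loose_end (z @ concat (map item (rev (map ?it ys)))), loose_end []])" for v ys
  proof (induction ys arbitrary: v)
    case Nil
    then show ?case by (simp add: reaches_refl)
  next
    case (Cons x ys)
    have "Blank \<notin> set (z @ concat (map item (rev (map ?it ys))))"
      using 2(3) Blank_not_in_item by auto
    from reaches_trans[OF Cons[of "v @ encode_portrait xs (c x)"] 2(2)[OF this, of x v]]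
    have "reaches control_step ((\<Sum>x\<leftarrow>ys. cost (c x)) + cost (c x))
     (Main, [on_top (map In (v @ concat (map (\<lambda>x. encode_portrait xs (c x)) (x # ys)))), r, loose_end z, loose_end []])
     (Main, [on_top (map In v), r, loose_end (z @ concat (map item (rev (map ?it (x # ys))))), loose_end []])"
      by simp
    then show ?case by (simp only: list.map sum_list.Cons add.commute)
  qed
  let ?w = "concat (map2 (\<lambda>x p. concat (map (lift x) (snd p))) xs (map ?it xs))"
  let ?n = "node_item \<sigma> (map fst (map ?it xs))"
  let ?z = "z @ concat (map item (rev (map ?it xs)))"
  have step: "step_of control_step (Main, [on_top (map In v @ [In (Inr \<sigma>)]), r, loose_end ?z, loose_end []])
    = (Reduce \<sigma> [] [], [on_top (map In v), r, on_top ?z, loose_end []])" for v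
    by (simp add: step_of_def)
  have reduce: "reaches control_step (\<Sum>p\<leftarrow>map ?it xs. (L + 1) * length (snd p) + 1)
     (Reduce \<sigma> [] [], [on_top (map In v), r, on_top ?z, loose_end []])
     (Write (fst ?n) (snd ?n), [on_top (map In v), r, on_top z, loose_end (map Out ?w)])"
  proof -
    have "snd p \<in> lists B \<and> fst p \<in> T" if "p \<in> set (map ?it xs)" for p
      using that collapse_closed[OF 2(1)] by auto
    from run_reduce_items[OF _ _ this, of "map ?it xs" "[]" \<sigma> "on_top (map In v)" r z "[]"]
    show ?thesis using xs by simp
  qed
  have enc: "v @ encode_portrait xs (Node \<sigma> c) = (v @ [Inr \<sigma>]) @ concat (map (\<lambda>x. encode_portrait xs (c x)) xs)"
    by simp
  have coll: "collapse (Node \<sigma> c) = (fst ?n, ?w @ snd ?n)"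
    by (simp add: Let_def)
  let ?k = "(\<Sum>p\<leftarrow>map ?it xs. (L + 1) * length (snd p) + 1) +
    (length (snd ?n) + (2 + (length (?w @ snd ?n) + 1)))"
  have "reaches control_step ?k (Reduce \<sigma> [] [], [on_top (map In v), r, on_top ?z, loose_end []])
     (Main, [on_top (map In v), r, loose_end (z @ item (fst ?n, ?w @ snd ?n)), loose_end []])"
    by (rule reaches_trans[OF reduce run_write[OF 2(3)]])
  then have last: "reaches control_step (Suc ?k) (Main, [on_top (map In (v @ [Inr \<sigma>])), r, loose_end ?z, loose_end []])
     (Main, [on_top (map In v), r, loose_end (z @ item (fst ?n, ?w @ snd ?n)), loose_end []])"
    by (intro reaches_step) (simp only: step map_append list.map)
  have "reaches control_step ((\<Sum>x\<leftarrow>xs. cost (c x)) + Suc ?k)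
     (Main, [on_top (map In (v @ encode_portrait xs (Node \<sigma> c))), r, loose_end z, loose_end []])
     (Main, [on_top (map In v), r, loose_end (z @ item (collapse (Node \<sigma> c))), loose_end []])"
    unfolding enc coll by (rule reaches_trans[OF children last])
  moreover have "(\<Sum>x\<leftarrow>xs. cost (c x)) + Suc ?k \<le> cost (Node \<sigma> c)"
    unfolding cost.simps coll by (simp add: comp_def)
  ultimately show ?case
    by (rule reaches_mono)
qed

lemma run_scan:
  "i \<le> length u \<Longrightarrow> reaches control_step (Suc (length u - i))
     (Scan, [(word_on_tape (map In u), i), loose_end r, loose_end s, loose_end t])
     (Main, [on_top (map In u), loose_end r, loose_end s, loose_end t])"
proof (induction i rule: inc_induct)
  case base
  have "(word_on_tape (map In u), length u) = loose_end (map In u :: ('x label, 'x aut) symbol list)"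
    by (simp add: loose_end_def)
  then show ?case
    by (auto simp: step_of_def reaches_refl intro!: reaches_step)
next
  case (step i)
  have "step_of control_step (Scan, [(word_on_tape (map In u), i), loose_end r, loose_end s, loose_end t])
     = (Scan, [(word_on_tape (map In u), Suc i), loose_end r, loose_end s, loose_end t])"
    using step.hyps by (auto simp: step_of_def word_on_tape_def fun_eq_iff)
  then have "reaches control_step (Suc (Suc (length u - Suc i)))
     (Scan, [(word_on_tape (map In u), i), loose_end r, loose_end s, loose_end t])
     (Main, [on_top (map In u), loose_end r, loose_end s, loose_end t])"
    using step.IH by (intro reaches_step[where k = "Suc (length u - Suc i)"]) simp
  then show ?case
    using step.hyps by (simp add: Suc_diff_Suc)
qed

lemma run_emit_pending:
  "reaches control_step (length p) (Emit p, [a, loose_end y, on_top z, loose_end t])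
     (Emit [], [a, loose_end (y @ map Out p), on_top z, loose_end t])"
proof (induction p arbitrary: y)
  case Nil
  then show ?case by (simp add: reaches_refl)
next
  case (Cons b p)
  have "step_of control_step (Emit (b # p), [a, loose_end y, on_top z, loose_end t])
     = (Emit p, [a, loose_end (y @ [Out b]), on_top z, loose_end t])"
    by (simp add: step_of_def)
  then show ?case
    using Cons[of "y @ [Out b]"] by (auto intro: reaches_step)
qed

lemma run_emit_letter:
  assumes "s = Out b \<and> b \<in> B \<or> s = In (Inl b) \<and> b \<in> T"
  shows "reaches control_step (L + 1) (Emit [], [a, loose_end y, on_top (z @ [s]), loose_end t])
     (Emit [], [a, loose_end (y @ map Out (spell b)), on_top z, loose_end t])"
proof -
  have "step_of control_step (Emit [], [a, loose_end y, on_top (z @ [s]), loose_end t])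
     = (Emit (spell b), [a, loose_end y, on_top z, loose_end t])"
    using assms by (auto simp: step_of_def)
  then have "reaches control_step (Suc (length (spell b))) (Emit [], [a, loose_end y, on_top (z @ [s]), loose_end t])
     (Emit [], [a, loose_end (y @ map Out (spell b)), on_top z, loose_end t])"
    using run_emit_pending[of "spell b"] by (intro reaches_step) simp
  then show ?thesis
    by (rule reaches_mono) (use spell[of b] assms in auto)
qed

lemma run_emit_word:
  assumes "w \<in> lists B"
  shows "reaches control_step ((L + 1) * length w)
     (Emit [], [a, loose_end y, on_top (z @ rev (map Out w)), loose_end t])
     (Emit [], [a, loose_end (y @ map Out (concat (map spell w))), on_top z, loose_end t])"
  using assms
proof (induction w arbitrary: y rule: list.induct)
  case Nil
  then show ?case by (simp add: reaches_refl)
next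
  case (Cons b w)
  have "reaches control_step ((L + 1) + (L + 1) * length w)
     (Emit [], [a, loose_end y, on_top ((z @ rev (map Out w)) @ [Out b]), loose_end t])
     (Emit [], [a, loose_end ((y @ map Out (spell b)) @ map Out (concat (map spell w))), on_top z, loose_end t])"
    by (rule reaches_trans[OF run_emit_letter Cons.IH]) (use Cons.prems in auto)
  then show ?case by simp
qed

definition output_word :: "('x, 'x aut) portrait \<Rightarrow> 'x aut list" where
  "output_word p = concat (map spell (snd (collapse p))) @ spell (fst (collapse p))"

lemma run_machine:
  assumes "shallow A h p"
  shows "reaches control_step (length (encode_portrait xs p) + cost p + (L + 1) * length (snd (collapse p)) + L + 3)
     (Scan, [(word_on_tape (map In (encode_portrait xs p)), 0), loose_end [], loose_end [], loose_end []])
     (Emit [], [on_top [], loose_end (map Out (output_word p)), on_top [], loose_end []])"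
proof -
  let ?c = "collapse p"
  note c = collapse_closed[OF assms]
  have 1: "reaches control_step (Suc (length (encode_portrait xs p) - 0))
     (Scan, [(word_on_tape (map In (encode_portrait xs p)), 0), loose_end [], loose_end [], loose_end []])
     (Main, [on_top (map In ([] @ encode_portrait xs p)), loose_end [], loose_end [], loose_end []])"
    using run_scan[of 0 "encode_portrait xs p" "[]" "[]" "[]"] by simp
  have 2: "reaches control_step (cost p)
     (Main, [on_top (map In ([] @ encode_portrait xs p)), loose_end [], loose_end [], loose_end []])
     (Main, [on_top (map In []), loose_end [], loose_end ([] @ item ?c), loose_end []])"
    by (rule run_portrait[OF assms]) simp
  \<comment> \<open>The blank on the used-up input tape sends \<open>Main\<close> to
    \<open>Emit []\<close>; this is the extra step.\<close>
  have 3: "reaches control_step (Suc ((L + 1) * length (snd ?c)))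
     (Main, [on_top (map In []), loose_end [], loose_end ([] @ item ?c), loose_end []])
     (Emit [], [on_top [], loose_end ([] @ map Out (concat (map spell (snd ?c)))),
        on_top ([] @ [In (Inl (fst ?c))]), loose_end []])"
    by (rule reaches_step)
      (use run_emit_word[of "snd ?c" "on_top []" "[]" "[In (Inl (fst ?c))]" "[]"] c in
        \<open>simp add: step_of_def item_def\<close>)
  have 4: "reaches control_step (L + 1)
     (Emit [], [on_top [], loose_end ([] @ map Out (concat (map spell (snd ?c)))),
        on_top ([] @ [In (Inl (fst ?c))]), loose_end []])
     (Emit [], [on_top [], loose_end (([] @ map Out (concat (map spell (snd ?c)))) @ map Out (spell (fst ?c))),
        on_top [], loose_end []])"
    by (rule run_emit_letter) (use c in simp)
  have "([] @ map Out (concat (map spell (snd ?c)))) @ map Out (spell (fst ?c)) = map Out (output_word p)"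
    by (simp add: output_word_def)
  from reaches_trans[OF 1 reaches_trans[OF 2 reaches_trans[OF 3 4]], unfolded this]
  show ?thesis
    by (rule reaches_mono) simp
qed

section \<open>Growth of words and running time with the depth\<close>

definition word_growth :: nat where
  "word_growth = length xs * L + L + 1"

text \<open>The summands match \<open>cost\<close> at a vertex: the children, the overhead 4,
  popping their items, and writing and transferring the new word, which \<open>word_growth\<close>
  controls.\<close>

definition time_growth :: nat where
  "time_growth = length xs + 4 + length xs * (L + 1) + 2 * word_growth"

lemma sum_list_bound: "(\<And>x. f x \<le> m) \<Longrightarrow> (\<Sum>x\<leftarrow>ys. f x) \<le> length ys * (m :: nat)"
  by (induction ys) (auto simp: add_mono)

lemma length_concat_bound:
  "(\<And>b. b \<in> set w \<Longrightarrow> length (f b) \<le> m) \<Longrightarrow> length (concat (map f w)) \<le> m * length w"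
  by (induction w) (auto simp: add_mono)

text \<open>The \<open>Suc\<close> represents the marker: it later pays for popping it and for
  spelling the coset representative.\<close>

lemma length_collapse:
  "shallow A h p \<Longrightarrow> Suc (length (snd (collapse p))) \<le> word_growth ^ Suc h"
proof (induction rule: shallow.induct)
  case (1 g h)
  have "Suc (length (snd (collapse (Leaf g :: ('x, 'x aut) portrait)))) \<le> word_growth ^ 1"
    using leaf_item[of g] 1 by (simp add: word_growth_def)
  also have "\<dots> \<le> word_growth ^ Suc h"
    by (rule power_increasing) (auto simp: word_growth_def)
  finally show ?case .
next
  case (2 h c \<sigma>)
  let ?it = "\<lambda>x. collapse (c x)" and ?P = "word_growth ^ Suc h"
  let ?n = "node_item \<sigma> (map fst (map ?it xs))"
  have each: "length (concat (map (lift x) (snd (?it x)))) \<le> L * ?P" for x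
  proof -
    have "length (concat (map (lift x) (snd (?it x)))) \<le> L * length (snd (?it x))"
      using collapse_closed[OF 2(1), of x] lift by (intro length_concat_bound) auto
    also have "\<dots> \<le> L * ?P"
      using 2(2)[of x] by (intro mult_le_mono2) simp
    finally show ?thesis .
  qed
  have "map fst (map ?it xs) \<in> lists T"
    using collapse_closed[OF 2(1)] by auto
  then have n: "length (snd ?n) \<le> L"
    using node_item[of "map fst (map ?it xs)" \<sigma>] by simp
  have "length (concat (map2 (\<lambda>x p. concat (map (lift x) (snd p))) xs (map ?it xs))) \<le> length xs * (L * ?P)"
    unfolding map2_map_self length_concat[of "map _ xs"] map_map comp_def by (rule sum_list_bound) (rule each)
  then have "Suc (length (snd (collapse (Node \<sigma> c)))) \<le> length xs * (L * ?P) + (L + 1)"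
    using n by (simp add: Let_def)
  also have "\<dots> \<le> length xs * (L * ?P) + (L + 1) * ?P"
  proof -
    have "1 \<le> ?P"
      by (rule one_le_power) (simp add: word_growth_def)
    then have "(L + 1) * 1 \<le> (L + 1) * ?P"
      by (rule mult_le_mono2)
    then show ?thesis by simp
  qed
  also have "\<dots> = word_growth ^ Suc (Suc h)"
    by (simp add: word_growth_def algebra_simps)
  finally show ?case .
qed

lemma growth_le: "word_growth \<le> time_growth"
  by (simp add: time_growth_def)

lemma cost_bound: "shallow A h p \<Longrightarrow> cost p \<le> time_growth ^ Suc h"
proof (induction rule: shallow.induct)
  case (1 g h)
  have "cost (Leaf g :: ('x, 'x aut) portrait) \<le> time_growth ^ 1"
    using leaf_item[of g] 1 by (simp add: time_growth_def word_growth_def)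
  also have "\<dots> \<le> time_growth ^ Suc h"
    by (rule power_increasing) (auto simp: time_growth_def)
  finally show ?case .
next
  case (2 h c \<sigma>)
  let ?P = "time_growth ^ Suc h"
  have P: "word_growth ^ Suc h \<le> ?P" "1 \<le> ?P"
    by (rule power_mono[OF growth_le]) (auto simp: time_growth_def)
  have "shallow A (Suc h) (Node \<sigma> c)"
    using 2 by (auto intro: shallow.intros)
  from length_collapse[OF this] have "length (snd (collapse (Node \<sigma> c))) \<le> word_growth * word_growth ^ Suc h"
    by simp
  also have "\<dots> \<le> word_growth * ?P"
    using P by (intro mult_le_mono2)
  finally have w: "length (snd (collapse (Node \<sigma> c))) \<le> word_growth * ?P" .
  have "(L + 1) * length (snd (collapse (c x))) + 1 \<le> (L + 1) * ?P" for x
  proof -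
    have "Suc (length (snd (collapse (c x)))) \<le> ?P"
      using length_collapse[OF 2(1)[of x]] P by linarith
    then have "(L + 1) * Suc (length (snd (collapse (c x)))) \<le> (L + 1) * ?P"
      by (rule mult_le_mono2)
    then show ?thesis by simp
  qed
  then have "(\<Sum>x\<leftarrow>xs. (L + 1) * length (snd (collapse (c x))) + 1) \<le> length xs * ((L + 1) * ?P)"
    by (rule sum_list_bound)
  moreover have "(\<Sum>x\<leftarrow>xs. cost (c x)) \<le> length xs * ?P"
    by (rule sum_list_bound) (rule 2(2))
  moreover have "4 \<le> 4 * ?P"
    using P by simp
  ultimately have "cost (Node \<sigma> c) \<le> length xs * ?P + 4 * ?P + length xs * ((L + 1) * ?P) + 2 * (word_growth * ?P)"
    unfolding cost.simps using w by linarith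
  also have "\<dots> = time_growth ^ Suc (Suc h)"
    by (simp add: time_growth_def algebra_simps)
  finally show ?case .
qed

lemma length_encode: "shallow A h p \<Longrightarrow> length (encode_portrait xs p) \<le> time_growth ^ Suc h"
proof (induction rule: shallow.induct)
  case (1 g h)
  have "1 \<le> time_growth ^ Suc h"
    by (rule one_le_power) (simp add: time_growth_def)
  then show ?case by simp
next
  case (2 h c \<sigma>)
  let ?P = "time_growth ^ Suc h"
  have P: "1 \<le> ?P"
    by (rule one_le_power) (simp add: time_growth_def)
  have "(\<Sum>x\<leftarrow>xs. length (encode_portrait xs (c x))) \<le> length xs * ?P"
    by (rule sum_list_bound) (rule 2(2))
  then have "length (encode_portrait xs (Node \<sigma> c)) \<le> (length xs + 1) * ?P"
    using P by (simp add: length_concat comp_def del: power_Suc)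
  also have "\<dots> \<le> time_growth * ?P"
    by (rule mult_le_mono1) (simp add: time_growth_def)
  finally show ?case by simp
qed

lemma encode_in: "shallow A h p \<Longrightarrow> encode_portrait xs p \<in> lists (Inl ` A \<union> range Inr)"
  by (induction rule: shallow.induct) (fastforce simp: in_lists_conv_set)+

lemma output_in: "shallow A h p \<Longrightarrow> output_word p \<in> lists S"
  using collapse_closed[of h p] spell by (fastforce simp: output_word_def)

lemma length_output:
  assumes "shallow A h p"
  shows "length (output_word p) \<le> L * time_growth ^ Suc h"
proof -
  have "length (concat (map spell (snd (collapse p)))) \<le> L * length (snd (collapse p))"
    using collapse_closed[OF assms] spell by (intro length_concat_bound) auto
  moreover have "length (spell (fst (collapse p))) \<le> L"
    using collapse_closed[OF assms] spell by auto
  ultimately have "length (output_word p) \<le> L * Suc (length (snd (collapse p)))"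
    by (simp add: output_word_def)
  also have "\<dots> \<le> L * word_growth ^ Suc h"
    using length_collapse[OF assms] by (rule mult_le_mono2)
  also have "\<dots> \<le> L * time_growth ^ Suc h"
    by (intro mult_le_mono2 power_mono growth_le) simp
  finally show ?thesis .
qed

text \<open>\<open>2 * L + 6\<close> adds up 1 for the input length, 1 for \<open>cost\<close>,
  \<open>L + 1\<close> for emitting the word and \<open>L + 3\<close> for constant overhead. One
  machine serves all depths \<open>h\<close>.\<close>

theorem machine:
  obtains M :: "('x label, 'x aut) tm" where "turing_machine (Inl ` A \<union> range Inr) M"
    and "\<And>h p t. shallow A h p \<Longrightarrow> (2 * L + 6) * time_growth ^ Suc h \<le> t \<Longrightarrow>
      computes_within M (encode_portrait xs p) (output_word p) t"
proof -
  have sub: "Scan \<in> states" "Blank \<in> syms" "In ` (Inl ` A \<union> range Inr) \<subseteq> syms" "(2 :: nat) \<le> 4"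
    by (auto simp: states_def syms_def)
  obtain M :: "('x label, 'x aut) tm" where tm: "turing_machine (Inl ` A \<union> range Inr) M"
    and M: "\<And>u q tps w j t. \<lbrakk>u \<in> lists (Inl ` A \<union> range Inr);
       (step_of control_step ^^ j) (Scan, (word_on_tape (map In u), 0) # replicate (4 - 1) (word_on_tape [], 0)) = (q, tps);
       control_step q (map read_tape tps) = None; fst (tps ! 1) = word_on_tape (map Out w); j \<le> t\<rbrakk>
       \<Longrightarrow> computes_within M u w t"
    by (rule abstract_machine[OF finite_states sub(1) finite_syms sub(2-4), of control_step])
      (erule (3) trans_closed, blast)
  have "computes_within M (encode_portrait xs p) (output_word p) t"
    if p: "shallow A h p" and t: "(2 * L + 6) * time_growth ^ Suc h \<le> t" for h p t
  proof -
    let ?P = "time_growth ^ Suc h"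
    have P: "word_growth ^ Suc h \<le> ?P" "1 \<le> ?P"
      by (rule power_mono[OF growth_le]) (auto simp: time_growth_def)
    have start: "(Scan, (word_on_tape (map In u), 0) # replicate (4 - 1) (word_on_tape [], 0))
      = (Scan, [(word_on_tape (map In u), 0), loose_end [], loose_end [], loose_end []])" for u
      by (simp add: loose_end_def numeral_eq_Suc)
    obtain j where j: "j \<le> length (encode_portrait xs p) + cost p + (L + 1) * length (snd (collapse p)) + L + 3"
      and run: "(step_of control_step ^^ j) (Scan, (word_on_tape (map In (encode_portrait xs p)), 0) # replicate (4 - 1) (word_on_tape [], 0))
        = (Emit [], [on_top [], loose_end (map Out (output_word p)), on_top [], loose_end []])"
      using run_machine[OF p] unfolding start reaches_def by blast
    have "length (snd (collapse p)) \<le> ?P"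
      using length_collapse[OF p] P by linarith
    then have "length (encode_portrait xs p) + cost p + (L + 1) * length (snd (collapse p)) + (L + 3) * 1
        \<le> ?P + ?P + (L + 1) * ?P + (L + 3) * ?P"
      by (intro add_mono mult_le_mono2 length_encode[OF p] cost_bound[OF p] P)
    with j have "j \<le> ?P + ?P + (L + 1) * ?P + (L + 3) * ?P"
      by simp
    also have "\<dots> = (2 * L + 6) * ?P"
      by (simp add: algebra_simps)
    also note t
    finally show ?thesis
      by (intro M[OF encode_in[OF p] run]) (simp_all add: loose_end_def)
  qed
  then show ?thesis
    using that tm by blast
qed

end

section \<open>Evaluating portraits\<close>

context portrait_transducer
begin

text \<open>Placing elements in the section at \<open>x\<close> respects products, so substituting
  letters suffices for whole words.\<close>

lemma word_value_lift:
  assumes "\<And>b. b \<in> B \<Longrightarrow> word_value (lift x b) = graft id (\<lambda>y. if y = x then b else id)"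
    and "w \<in> lists B"
  shows "word_value (concat (map (lift x) w)) = graft id (\<lambda>y. if y = x then word_value w else id)"
  using assms(2)
proof (induction w rule: list.induct)
  case Nil
  show ?case by (simp only: list.map concat.simps word_value_simps if_cancel graft_id)
next
  case (Cons b w)
  have IH: "word_value (concat (map (lift x) w)) = graft id (\<lambda>y. if y = x then word_value w else id)"
    by (rule Cons.IH) (use Cons.prems in simp)
  have b: "word_value (lift x b) = graft id (\<lambda>y. if y = x then b else id)"
    by (rule assms(1)) (use Cons.prems in simp)
  have "word_value (concat (map (lift x) (b # w))) = word_value (concat (map (lift x) w)) \<circ> word_value (lift x b)"
    by (simp add: word_value_append)
  also have "\<dots> = graft id (\<lambda>y. if y = x then word_value w else id) \<circ> graft id (\<lambda>y. if y = x then b else id)"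
    by (simp only: IH b)
  also have "\<dots> = graft id (\<lambda>y. if y = x then word_value (b # w) else id)"
    unfolding graft_comp by (rule arg_cong[where f = "graft id"]) auto
  finally show ?case .
qed

text \<open>By \<open>distinct\<close>, each coordinate is filled by at most one factor, all others
  being trivial there.\<close>

lemma word_value_lifts:
  assumes "\<And>x b. b \<in> B \<Longrightarrow> word_value (lift x b) = graft id (\<lambda>y. if y = x then b else id)"
    and "distinct ys" and "\<And>x. f x \<in> lists B"
  shows "word_value (concat (map (\<lambda>x. concat (map (lift x) (f x))) ys))
    = graft id (\<lambda>y. if y \<in> set ys then word_value (f y) else id)"
  using assms(2)
proof (induction ys)
  case Nil
  show ?case by (simp only: list.map concat.simps word_value_simps list.set empty_iff if_False graft_id)
next
  case (Cons x ys)
  have IH: "word_value (concat (map (\<lambda>x. concat (map (lift x) (f x))) ys))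
     = graft id (\<lambda>y. if y \<in> set ys then word_value (f y) else id)"
    by (rule Cons.IH) (use Cons.prems in simp)
  have x: "word_value (concat (map (lift x) (f x))) = graft id (\<lambda>y. if y = x then word_value (f x) else id)"
    by (rule word_value_lift[OF assms(1,3)])
  have "word_value (concat (map (\<lambda>x. concat (map (lift x) (f x))) (x # ys)))
     = word_value (concat (map (\<lambda>x. concat (map (lift x) (f x))) ys)) \<circ> word_value (concat (map (lift x) (f x)))"
    by (simp add: word_value_append)
  also have "\<dots> = graft id (\<lambda>y. if y \<in> set ys then word_value (f y) else id) \<circ>
       graft id (\<lambda>y. if y = x then word_value (f x) else id)"
    by (simp only: IH x)
  also have "\<dots> = graft id (\<lambda>y. if y \<in> set (x # ys) then word_value (f y) else id)"
    unfolding graft_comp by (rule arg_cong[where f = "graft id"]) (use Cons.prems in auto)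
  finally show ?case .
qed

text \<open>Let \<open>k\<close> be the graft of the children's words and \<open>m\<close> that of
  their representatives, so that \<open>g\<close> is \<open>k\<close> followed by \<open>m\<close>.
  Since \<open>g\<close> and \<open>k\<close> lie in \<open>G\<close>, so does \<open>m\<close>, and
  for such \<open>m\<close> the table promises a factorization.\<close>

lemma collapse_value:
  assumes "distinct xs" and G: "self_similar G"
    and lift_value: "\<And>x b. b \<in> B \<Longrightarrow> word_value (lift x b) = graft id (\<lambda>y. if y = x then b else id)"
    and kernel: "\<And>f. (\<And>x. f x \<in> lists B) \<Longrightarrow> graft id (\<lambda>x. word_value (f x)) \<in> G"
    and leaf_value: "\<And>g. g \<in> A \<Longrightarrow> fst (leaf_item g) \<circ> word_value (snd (leaf_item g)) = g"
    and node_value: "\<And>\<sigma> ts. graft \<sigma> (\<lambda>x. the (map_of (zip xs ts) x)) \<in> G \<Longrightarrow>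
      fst (node_item \<sigma> ts) \<circ> word_value (snd (node_item \<sigma> ts)) = graft \<sigma> (\<lambda>x. the (map_of (zip xs ts) x))"
    and "is_portrait A g p" "shallow A h p" "g \<in> G"
  shows "fst (collapse p) \<circ> word_value (snd (collapse p)) = g"
  using assms(7-9)
proof (induction arbitrary: h rule: is_portrait.induct)
  case (leaf g)
  then show ?case using leaf_value by simp
next
  case (node g c)
  let ?it = "\<lambda>x. collapse (c x)" and ?\<sigma> = "perm_at_root g"
  obtain h' where "\<forall>x. shallow A h' (c x)"
    using node.prems(1) by cases auto
  then have sh: "shallow A h' (c x)" for x
    by blast
  have B: "snd (?it x) \<in> lists B" for x
    using collapse_closed[OF sh] by blast
  let ?w = "concat (map (\<lambda>x. concat (map (lift x) (snd (?it x)))) xs)"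
  let ?k = "graft id (\<lambda>x. word_value (snd (?it x)))" and ?m = "graft ?\<sigma> (\<lambda>x. fst (?it x))"
  have k: "word_value ?w = ?k"
    using word_value_lifts[OF lift_value assms(1) B] xs by simp
  have sec: "fst (?it x) \<circ> word_value (snd (?it x)) = section_at g [x]" for x
    by (rule node.IH[OF sh]) (rule section_at_in[OF G node.prems(2)])
  have g: "g = ?m \<circ> ?k"
    using graft_decomposition[OF self_similar_subset[OF G node.prems(2)]] by (simp add: graft_comp sec)
  have kG: "?k \<in> G"
    by (rule kernel) (rule B)
  let ?i = "inv\<^bsub>AutT\<^esub> ?k"
  have i: "?i \<in> G" "?k \<circ> ?i = id"
    using subgroup.m_inv_closed[of G AutT ?k] G kG group.l_inv[OF group_AutT, of ?k]
      self_similar_subset[OF G kG] by (auto simp: self_similar_def)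
  have "?m = g \<circ> ?i"
    by (subst g) (simp add: comp_assoc i)
  then have m: "?m \<in> G"
    using self_similar_comp[OF G i(1) node.prems(2)] by simp
  \<comment> \<open>The table receives the representatives as a list; \<open>map_of\<close> on the
    zipped list recovers the function on the alphabet.\<close>
  have ts: "(\<lambda>x. the (map_of (zip xs (map fst (map ?it xs))) x)) = (\<lambda>x. fst (?it x))"
    using xs by (simp add: map_of_zip_map comp_def fun_eq_iff)
  have "fst (collapse (Node ?\<sigma> c)) \<circ> word_value (snd (collapse (Node ?\<sigma> c))) =
     (fst (node_item ?\<sigma> (map fst (map ?it xs))) \<circ> word_value (snd (node_item ?\<sigma> (map fst (map ?it xs))))) \<circ> word_value ?w"
    by (simp only: collapse.simps Let_def fst_conv snd_conv map2_map_self word_value_append comp_assoc)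
  also have "\<dots> = ?m \<circ> ?k"
    unfolding k by (subst node_value) (simp_all only: ts m)
  finally show ?case
    using g by simp
qed

lemma output_value:
  assumes "\<And>g. g \<in> B \<union> T \<Longrightarrow> word_value (spell g) = g" "shallow A h p"
  shows "word_value (output_word p) = fst (collapse p) \<circ> word_value (snd (collapse p))"
proof -
  have "word_value (concat (map spell w)) = word_value w" if "w \<in> lists B" for w
    using that assms(1) by (induction w rule: list.induct) (simp_all add: word_value_append)
  then show ?thesis
    using collapse_closed[OF assms(2)] assms(1) by (simp add: output_word_def word_value_append)
qed

end

section \<open>Depth of portraits, branching and the polynomial bound\<close>

lemma shallow_portrait:
  assumes "is_portrait N g p" "\<And>v. h \<le> length v \<Longrightarrow> section_at g v \<in> N"
  shows "shallow N h p"
  using assms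
proof (induction arbitrary: h rule: is_portrait.induct)
  case (leaf g)
  then show ?case by (auto intro: shallow.intros)
next
  case (node g c)
  \<comment> \<open>\<open>h = 0\<close> would force \<open>g\<close>, its own section at the empty
    word, into \<open>N\<close>.\<close>
  obtain h' where h: "h = Suc h'"
    using node.hyps node.prems[of "[]"] by (cases h) auto
  have "shallow N h' (c x)" for x
    by (rule node.IH) (use node.prems[of "x # _"] in \<open>simp add: section_at_section_at h\<close>)
  then show ?case
    unfolding h by (rule shallow.intros)
qed

text \<open>The branching inclusion provides an element of \<open>K\<close> that fixes level one and
  has sections \<open>f\<close>; an automorphism is determined by its root permutation and
  sections.\<close>

lemma branching_graft:
  assumes G: "self_similar G" and K: "K \<subseteq> G"
    and branch: "(\<Pi>\<^sub>E x\<in>UNIV. K) \<subseteq> level1_sections ` (level1_stabilizer G \<inter> K)"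
    and f: "\<And>x. f x \<in> K"
  shows "graft id f \<in> K"
proof -
  have "f \<in> (\<Pi>\<^sub>E x\<in>UNIV. K)"
    using f by (simp add: PiE_iff)
  then obtain k where k: "k \<in> K" "\<And>x. k [x] = [x]" "f = level1_sections k"
    using branch by (auto simp: level1_stabilizer_def)
  have "perm_at_root k = id"
    by (simp add: perm_at_root_def k(2) fun_eq_iff)
  then have "k = graft id f"
    using graft_decomposition[of k] self_similar_subset[OF G] K k by (auto simp: level1_sections_def)
  then show ?thesis
    using k by simp
qed

text \<open>The Schreier lemma inside the group \<open>G\<close>. As actions are on the right, the
  product of \<open>w\<close> and \<open>t\<close> becomes
  \<open>t \<circ> word_value w\<close>.\<close>

lemma branch_generators:
  assumes G: "self_similar G" and K: "subgroup K AutT" "K \<subseteq> G" "finite_index AutT G K"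
    and S: "finite S" "\<forall>s\<in>S. inv\<^bsub>AutT\<^esub> s \<in> S" "generate AutT S = G"
  obtains T B where "finite T" "T \<subseteq> G" "finite B" "B \<subseteq> K"
    and "\<And>g. g \<in> G \<Longrightarrow> \<exists>p. fst p \<in> T \<and> snd p \<in> lists B \<and> fst p \<circ> word_value (snd p) = g"
    and "\<And>g. g \<in> K \<Longrightarrow> \<exists>w\<in>lists B. word_value w = g"
proof -
  let ?G = "AutT\<lparr>carrier := G\<rparr>"
  have sub: "subgroup G AutT"
    using G by (simp add: self_similar_def)
  interpret G: group ?G
    by (rule subgroup.subgroup_is_group[OF sub group_AutT])
  have value_eq: "foldr (\<otimes>\<^bsub>?G\<^esub>) w \<one>\<^bsub>?G\<^esub> = word_value w" for w
    by (induction w) simp_all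
  have "subgroup K ?G"
    by (rule group.subgroup_incl[OF group_AutT K(1) sub K(2)])
  moreover have "finite (rcosets\<^bsub>?G\<^esub> K)"
    using K(3) by (simp add: finite_index_def)
  moreover have "S \<subseteq> carrier ?G"
    using S(3) by (auto intro: generate.incl)
  moreover have "\<exists>w\<in>lists S. g = foldr (\<otimes>\<^bsub>?G\<^esub>) w \<one>\<^bsub>?G\<^esub>" if "g \<in> carrier ?G" for g
    using generate_word[OF S(2), of g] S(3) that unfolding value_eq by auto
  ultimately obtain T B where TB: "finite T" "T \<subseteq> carrier ?G" "finite B" "B \<subseteq> K"
    and T: "\<And>g. g \<in> carrier ?G \<Longrightarrow>
      \<exists>t\<in>T. \<exists>w\<in>lists B. g = foldr (\<otimes>\<^bsub>?G\<^esub>) w \<one>\<^bsub>?G\<^esub> \<otimes>\<^bsub>?G\<^esub> t"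
    and B: "\<And>g. g \<in> K \<Longrightarrow> \<exists>w\<in>lists B. g = foldr (\<otimes>\<^bsub>?G\<^esub>) w \<one>\<^bsub>?G\<^esub>"
    by (rule G.schreier_generators[OF _ _ S(1)]) (assumption, (rule that; assumption))
  note T = T[unfolded value_eq] and B = B[unfolded value_eq]
  show ?thesis
  proof (rule that[OF TB(1) _ TB(3,4)])
    show "T \<subseteq> G" using TB by simp
    show "\<exists>p. fst p \<in> T \<and> snd p \<in> lists B \<and> fst p \<circ> word_value (snd p) = g" if "g \<in> G" for g
      using T[of g] that by fastforce
    show "\<exists>w\<in>lists B. word_value w = g" if "g \<in> K" for g
      using B[OF that] by metis
  qed
qed

text \<open>Makes the exponential in the depth \<open>l * Suc m\<close> polynomial in
  \<open>n\<close>: \<open>e < 2 ^ e\<close> leads to a power of \<open>2 ^ m\<close>, which is at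
  most \<open>2 * n + 1\<close>, the value of \<open>[:1, 2:]\<close> at \<open>n\<close>.\<close>

lemma exponential_depth_bound:
  fixes c e l m n :: nat
  assumes "2 ^ m \<le> 2 * n + 1"
  shows "c * e ^ Suc (l * Suc m) \<le> poly ([:c * 2 ^ (e * Suc l):] * [:1, 2:] ^ (e * l)) n"
proof -
  have exponent: "e * Suc (l * Suc m) = e * Suc l + m * (e * l)"
    by (simp add: algebra_simps)
  have "e ^ Suc (l * Suc m) \<le> (2 ^ e) ^ Suc (l * Suc m)"
    by (rule power_mono[OF less_imp_le[OF less_exp]]) simp
  also have "\<dots> = 2 ^ (e * Suc l) * (2 ^ m) ^ (e * l)"
    unfolding power_mult[symmetric] power_add[symmetric] exponent ..
  also have "\<dots> \<le> 2 ^ (e * Suc l) * (2 * n + 1) ^ (e * l)"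
    by (rule mult_le_mono2, rule power_mono[OF assms]) simp
  finally have "c * e ^ Suc (l * Suc m) \<le> c * (2 ^ (e * Suc l) * (2 * n + 1) ^ (e * l))"
    by (rule mult_le_mono2)
  moreover have "poly [:1, 2:] n = 2 * n + 1" "poly [:a:] n = a" for a
    by simp_all
  ultimately show ?thesis
    by (simp only: poly_mult poly_power mult.assoc)
qed

text \<open>Bridges the gap between the machine, built for all self-maps of the alphabet, and
  portrait labels, which are bijections.\<close>

lemma turing_machine_subset:
  assumes "turing_machine A' M" "A \<subseteq> A'"
  shows "turing_machine A M"
proof -
  have "In ` A' \<subseteq> symbols M"
    using assms(1) unfolding turing_machine_def by (elim conjE)
  then have "In ` A \<subseteq> symbols M"
    by (rule order_trans[OF image_mono[OF assms(2)]])
  then show ?thesis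
    using assms(1) unfolding turing_machine_def by (elim conjE, intro conjI)
qed

theorem theorem5p8:
  fixes G S :: "('x::finite list \<Rightarrow> 'x list) set"
    and xs :: "'x list"
  assumes "self_similar G"
    and "contracting G"
    and "regular_branch G"
    and "finite S"
    and "\<forall>s\<in>S. inv\<^bsub>AutT\<^esub> s \<in> S"
    and "generate AutT S = G"
    and "nucleus G \<subseteq> S"
    and "distinct xs" and "set xs = UNIV"
  shows "\<exists>(M :: ('x label, 'x list \<Rightarrow> 'x list) tm) (p :: nat poly) (q :: nat poly).
    turing_machine (portrait_labels G) M \<and>
    (\<forall>n. \<forall>g\<in>G. (\<exists>u\<in>lists S. length u \<le> n \<and> word_value u = g) \<longrightarrow>
      (\<exists>w\<in>lists S. word_value w = g \<and> length w \<le> poly p n \<and>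
         computes_within M (encode_portrait xs (nucleus_portrait G g)) w (poly q n)))"
proof -
  let ?N = "nucleus G"
  note G = assms(1)
  obtain K where K: "subgroup K AutT" "K \<subseteq> G" "finite_index AutT G K"
    and branch: "(\<Pi>\<^sub>E x\<in>UNIV. K) \<subseteq> level1_sections ` (level1_stabilizer G \<inter> K)"
    using assms(3) by (auto simp: regular_branch_def regular_branch_over_def)
  note graft_K = branching_graft[OF G K(2) branch]
  have id_K: "id \<in> K"
    using subgroup.one_closed[OF K(1)] by simp
  have SG: "S \<subseteq> G"
    using assms(6) by (auto intro: generate.incl)
  obtain T B where TB: "finite T" "T \<subseteq> G" "finite B" "B \<subseteq> K"
    and T: "\<And>g. g \<in> G \<Longrightarrow> \<exists>p. fst p \<in> T \<and> snd p \<in> lists B \<and> fst p \<circ> word_value (snd p) = g"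
    and B: "\<And>g. g \<in> K \<Longrightarrow> \<exists>w\<in>lists B. word_value w = g"
    by (rule branch_generators[OF G K assms(4-6)]) (rule that; assumption)
  from T obtain dec where dec: "\<And>g. g \<in> G \<Longrightarrow>
      fst (dec g) \<in> T \<and> snd (dec g) \<in> lists B \<and> fst (dec g) \<circ> word_value (snd (dec g)) = g"
    by metis
  \<comment> \<open>A graft outside \<open>G\<close> never arises from the portrait of an element of
    \<open>G\<close>; \<open>dec id\<close> only makes the table total.\<close>
  define node where "node \<sigma> ts = (let m = graft \<sigma> (\<lambda>x. the (map_of (zip xs ts) x))
    in if m \<in> G then dec m else dec id)" for \<sigma> :: "'x \<Rightarrow> 'x" and ts
  have node: "fst (node \<sigma> ts) \<in> T \<and> snd (node \<sigma> ts) \<in> lists B" for \<sigma> ts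
    using dec[OF self_similar_id[OF G]] dec[of "graft \<sigma> (\<lambda>x. the (map_of (zip xs ts) x))"]
    by (auto simp only: node_def Let_def split: if_split)
  define lift where "lift x b = (SOME w. w \<in> lists B \<and> word_value w = graft id (\<lambda>y. if y = x then b else id))"
    for x :: 'x and b
  have lift_spec: "lift x b \<in> lists B \<and> word_value (lift x b) = graft id (\<lambda>y. if y = x then b else id)"
    if "b \<in> B" for x b
  proof -
    have "(if y = x then b else id) \<in> K" for y
      using that TB(4) id_K by auto
    then have "graft id (\<lambda>y. if y = x then b else id) \<in> K"
      by (rule graft_K)
    from B[OF this] have "\<exists>w. w \<in> lists B \<and> word_value w = graft id (\<lambda>y. if y = x then b else id)"
      by blast
    then show ?thesis
      unfolding lift_def by (rule someI_ex)
  qed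
  have "\<exists>w. w \<in> lists S \<and> word_value w = g" if "g \<in> G" for g
    using generate_word[OF assms(5), of g] assms(6) that by auto
  then obtain spell where spell_spec: "\<And>g. g \<in> G \<Longrightarrow> spell g \<in> lists S \<and> word_value (spell g) = g"
    by metis
  have N: "absorbs_sections G ?N"
    by (rule absorbs_nucleus(1)[OF assms(2)])
  then have NG: "finite ?N" "?N \<subseteq> G"
    by (auto simp: absorbs_sections_def)
  have BG: "B \<subseteq> G"
    using TB K by blast
  \<comment> \<open>The choices above do not depend on the input. Only the finitely many words
    listed here enter the control, so their maximal length \<open>L\<close> is a constant.\<close>
  define table where "table = (\<lambda>g. snd (dec g)) ` (?N \<union> T) \<union>
    (\<lambda>(\<sigma>, ts). snd (node \<sigma> ts)) ` (UNIV \<times> {ts. set ts \<subseteq> T \<and> length ts = length xs}) \<union>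
    (\<lambda>(x, b). lift x b) ` (UNIV \<times> B) \<union> spell ` (B \<union> T)"
  have "finite table"
    using TB NG finite_lists_length_eq[OF TB(1), of "length xs"] by (simp add: table_def)
  then obtain L where L: "\<And>w. w \<in> table \<Longrightarrow> length w \<le> L"
    using finite_nat_set_iff_bounded_le[of "length ` table"] by auto
  interpret portrait_transducer xs ?N T B S dec node lift spell L
  proof
    show "xs \<noteq> []" "set xs = UNIV"
      using assms(9) by auto
    show "finite ?N" "finite T" "finite B" "finite S"
      using NG TB assms(4) by auto
  next
    fix g assume "g \<in> ?N \<union> T"
    then show "fst (dec g) \<in> T \<and> snd (dec g) \<in> lists B \<and> length (snd (dec g)) \<le> L"
      using dec[of g] NG TB L by (auto simp: table_def)
  next
    fix ts \<sigma> assume "ts \<in> lists T" "length ts = length xs"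
    then have "snd (node \<sigma> ts) \<in> table"
      by (force simp: table_def)
    then show "fst (node \<sigma> ts) \<in> T \<and> snd (node \<sigma> ts) \<in> lists B \<and> length (snd (node \<sigma> ts)) \<le> L"
      using node L by blast
  next
    fix b x assume "b \<in> B"
    then have "lift x b \<in> table"
      by (force simp: table_def)
    then show "lift x b \<in> lists B \<and> length (lift x b) \<le> L"
      using lift_spec L \<open>b \<in> B\<close> by blast
  next
    fix g assume "g \<in> B \<union> T"
    then show "spell g \<in> lists S \<and> length (spell g) \<le> L"
      using spell_spec[of g] BG TB L by (auto simp: table_def)
  qed
  obtain M :: "('x label, 'x list \<Rightarrow> 'x list) tm" where M: "turing_machine (Inl ` ?N \<union> range Inr) M"
    and run: "\<And>h p t. shallow ?N h p \<Longrightarrow> (2 * L + 6) * time_growth ^ Suc h \<le> t \<Longrightarrow>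
      computes_within M (encode_portrait xs p) (output_word p) t"
    by (rule machine) (rule that; assumption)
  have "portrait_labels G \<subseteq> Inl ` ?N \<union> range Inr"
    by (auto simp: portrait_labels_def)
  then have M': "turing_machine (portrait_labels G) M"
    by (rule turing_machine_subset[OF M])
  obtain l where l: "\<And>m u v. u \<in> lists S \<Longrightarrow> length u \<le> 2 ^ m \<Longrightarrow> l * Suc m \<le> length v \<Longrightarrow>
    section_at (word_value u) v \<in> ?N"
    by (rule logarithmic_absorption[OF G N assms(4) SG assms(7)]) (rule that; assumption)
  let ?E = time_growth
  \<comment> \<open>A single polynomial serves for both word length and running time.\<close>
  define q where "q = [:(2 * L + 6) * 2 ^ (?E * Suc l):] * [:1, 2:] ^ (?E * l)"
  have bound: "(2 * L + 6) * ?E ^ Suc (l * Suc m) \<le> poly q n" if "2 ^ m \<le> 2 * n + 1" for m n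
    unfolding q_def by (rule exponential_depth_bound[OF that])
  have "\<exists>w\<in>lists S. word_value w = g \<and> length w \<le> poly q n \<and>
      computes_within M (encode_portrait xs (nucleus_portrait G g)) w (poly q n)"
    if g: "g \<in> G" and u: "u \<in> lists S" "length u \<le> n" "word_value u = g" for n g u
  proof -
    let ?p = "nucleus_portrait G g"
    obtain m where m: "n \<le> 2 ^ m" "2 ^ m \<le> 2 * n + (1 :: nat)"
      using ex_power_of_two by blast
    have p: "is_portrait ?N g ?p"
      by (rule is_portrait_nucleus[OF assms(2) g])
    \<comment> \<open>The unknown word \<open>u\<close> enters only here, through the depth of the
      portrait; the machine never sees it.\<close>
    have sh: "shallow ?N (l * Suc m) ?p"
    proof (rule shallow_portrait[OF p])
      show "section_at g v \<in> ?N" if "l * Suc m \<le> length v" for v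
        using l[OF u(1) order_trans[OF u(2) m(1)] that] u(3) by simp
    qed
    have "word_value (output_word ?p) = fst (collapse ?p) \<circ> word_value (snd (collapse ?p))"
    proof (rule output_value[OF _ sh])
      show "word_value (spell g) = g" if "g \<in> B \<union> T" for g
        by (rule conjunct2[OF spell_spec]) (use that BG TB(2) in blast)
    qed
    also have "\<dots> = g"
    proof (rule collapse_value[OF assms(8) G _ _ _ _ p sh g])
      show "word_value (lift x b) = graft id (\<lambda>y. if y = x then b else id)" if "b \<in> B" for x b
        using lift_spec[OF that] by (rule conjunct2)
      show "graft id (\<lambda>x. word_value (f x)) \<in> G" if "\<And>x. f x \<in> lists B" for f
      proof -
        have value_K: "word_value w \<in> K" if "w \<in> lists B" for w
          using that TB(4) id_K subgroup.m_closed[OF K(1)]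
          by (induction w rule: list.induct) auto
        have "graft id (\<lambda>x. word_value (f x)) \<in> K"
          by (rule graft_K) (rule value_K[OF that])
        then show ?thesis
          using K(2) by blast
      qed
      show "fst (dec g) \<circ> word_value (snd (dec g)) = g" if "g \<in> ?N" for g
        using dec[OF subsetD[OF NG(2) that]] by (elim conjE)
      show "fst (node \<sigma> ts) \<circ> word_value (snd (node \<sigma> ts)) = graft \<sigma> (\<lambda>x. the (map_of (zip xs ts) x))"
        if "graft \<sigma> (\<lambda>x. the (map_of (zip xs ts) x)) \<in> G" for \<sigma> ts
        using dec[OF that] that by (simp only: node_def Let_def if_True)
    qed
    finally have val: "word_value (output_word ?p) = g" .
    have "length (output_word ?p) \<le> L * ?E ^ Suc (l * Suc m)"
      by (rule length_output[OF sh])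
    also have "\<dots> \<le> (2 * L + 6) * ?E ^ Suc (l * Suc m)"
      by (rule mult_le_mono1) simp
    also note bound[OF m(2)]
    finally show ?thesis
      by (intro bexI[of _ "output_word ?p"] conjI val output_in[OF sh] run[OF sh bound[OF m(2)]])
  qed
  with M' show ?thesis
    by (intro exI[of _ M] exI[of _ q] conjI) auto
qed

end
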